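(* Let $\mathcal{H}$ be an infinite dimensional (complex) Hilbert space. Then $\operatorname{span} f(\mathcal{B}(\mathcal{H}))=\mathcal{B}(\mathcal{H})$ and $\operatorname{span} f(\mathcal{K}(\mathcal{H}))=\mathcal{K}(\mathcal{H})$ for every nonconstant polynomial $f\in\mathbb{C}\langle\bar X\rangle$.
   Context: $\mathcal{B}(\mathcal{H})$ and $\mathcal{K}(\mathcal{H})$ denote the algebras of all bounded and of all compact linear operators on $\mathcal{H}$, respectively. $\mathbb{C}\langle\bar X\rangle$ denotes the free algebra over $\mathbb{C}$ generated by $\bar X=\{X_1,X_2,\ldots\}$, i.e. the algebra of all noncommutative polynomials in the $X_i$ with complex coefficients. For a complex algebra $\mathcal{A}$ and $f=f(X_1,\ldots,X_n)\in\mathbb{C}\langle\bar X\rangle$, $f(\mathcal{A})$ denotes the set of all values $f(a_1,\ldots,a_n)$ with $a_i\in\mathcal{A}$, $i=1,\ldots,n$, and $\operatorname{span} f(\mathcal{A})$ denotes the linear span of $f(\mathcal{A})$.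
   Formalization: The claim for K(H) is stated only for polynomials f with zero constant term; if the constant term c is nonzero, f(0) = c·1 is not compact, so the equality with K(H) fails or f(K(H)) is undefined. *)

theory Defs
  imports "HOL-Analysis.Analysis" "HOL-Library.Poly_Mapping"
begin

section \<open>Complex Hilbert spaces\<close>

text \<open>
  The inner product is linear in the first argument. Extending the class of real normed vector
  spaces makes bounded linear maps and the metric topology of the library available; the axioms
  tie the real scaling and the norm to their complex counterparts.
\<close>

class complex_inner = real_normed_vector +
  fixes scaleC :: "complex \<Rightarrow> 'a \<Rightarrow> 'a" (infixr "*\<^sub>C" 75)
    and cinner :: "'a \<Rightarrow> 'a \<Rightarrow> complex"
  assumes scaleC_add_right: "c *\<^sub>C (x + y) = c *\<^sub>C x + c *\<^sub>C y"
    and scaleC_add_left: "(c + d) *\<^sub>C x = c *\<^sub>C x + d *\<^sub>C x"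
    and scaleC_scaleC: "c *\<^sub>C d *\<^sub>C x = (c * d) *\<^sub>C x"
    and scaleC_of_real: "of_real r *\<^sub>C x = r *\<^sub>R x"
    and cinner_commute: "cinner x y = cnj (cinner y x)"
    and cinner_add_left: "cinner (x + y) z = cinner x z + cinner y z"
    and cinner_scaleC_left: "cinner (c *\<^sub>C x) y = c * cinner x y"
    and cinner_self_norm: "cinner x x = of_real ((norm x)\<^sup>2)"

class chilbert_space = complex_inner + complete_space

interpretation complex_vector:
  vector_space "scaleC :: complex \<Rightarrow> 'a \<Rightarrow> 'a::complex_inner"
proof
  show "1 *\<^sub>C x = x" for x :: 'a
    using scaleC_of_real[of 1 x] by simp
qed (simp_all add: scaleC_add_right scaleC_add_left scaleC_scaleC)

lemma norm_scaleC: "norm (c *\<^sub>C x) = cmod c * norm (x :: 'a::complex_inner)"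
proof -
  have "cinner (c *\<^sub>C x) (c *\<^sub>C x) = c * cnj (c * cinner x x)"
    by (metis cinner_scaleC_left cinner_commute)
  also have "\<dots> = (c * cnj c) * of_real ((norm x)\<^sup>2)"
    by (simp add: cinner_self_norm)
  also have "\<dots> = of_real ((cmod c * norm x)\<^sup>2)"
    by (simp add: complex_norm_square[symmetric] power_mult_distrib flip: of_real_power)
  finally have "(norm (c *\<^sub>C x))\<^sup>2 = (cmod c * norm x)\<^sup>2"
    unfolding cinner_self_norm of_real_eq_iff .
  then show ?thesis
    by (simp add: power2_eq_iff_nonneg)
qed

lemma bounded_linear_scaleC: "bounded_linear (\<lambda>x :: 'a::complex_inner. c *\<^sub>C x)"
proof (rule bounded_linear_intro)
  show "c *\<^sub>C (r *\<^sub>R x) = r *\<^sub>R (c *\<^sub>C x)" for r and x :: 'a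
    by (simp add: scaleC_scaleC mult.commute flip: scaleC_of_real)
  show "norm (c *\<^sub>C x) \<le> norm x * cmod c" for x :: 'a
    by (simp add: norm_scaleC mult.commute)
qed (simp add: scaleC_add_right)


section \<open>Bounded and compact operators\<close>

text \<open>
  The library type of bounded \<^emph>\<open>real\<close>-linear maps from \<open>'a\<close> to itself is a complex algebra under
  pointwise operations and composition; the bounded complex-linear operators form a subalgebra.
\<close>

lift_definition scaleC_op ::
  "complex \<Rightarrow> ('a::complex_inner \<Rightarrow>\<^sub>L 'a) \<Rightarrow> ('a \<Rightarrow>\<^sub>L 'a)" is "\<lambda>c T x. c *\<^sub>C T x"
  by (rule bounded_linear_compose[OF bounded_linear_scaleC])

interpretation complex_op:
  vector_space "scaleC_op :: complex \<Rightarrow> ('a::complex_inner \<Rightarrow>\<^sub>L 'a) \<Rightarrow> ('a \<Rightarrow>\<^sub>L 'a)"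
  by standard
    (auto intro!: blinfun_eqI simp: scaleC_op.rep_eq blinfun.add_left scaleC_add_right
      scaleC_add_left scaleC_scaleC)

definition bounded_ops :: "('a::complex_inner \<Rightarrow>\<^sub>L 'a) set" where
  "bounded_ops = {T :: 'a \<Rightarrow>\<^sub>L 'a. \<forall>c x. T (c *\<^sub>C x) = c *\<^sub>C T x}"

definition compact_ops :: "('a::complex_inner \<Rightarrow>\<^sub>L 'a) set" where
  "compact_ops = {T \<in> bounded_ops. \<forall>S. bounded S \<longrightarrow> compact (closure (blinfun_apply T ` S))}"


section \<open>Noncommutative polynomials\<close>

text \<open>
  Words in the variables \<open>X\<^sub>i\<close> are lists of indices. With concatenation as the (additively written)
  monoid operation on lists, the convolution product of \<^theory>\<open>HOL-Library.Poly_Mapping\<close> turns the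
  finitely supported functions on words into the monoid algebra of the free monoid, that is, the
  free algebra. The empty word is the monomial 1.
\<close>

instantiation list :: (type) monoid_add
begin

definition zero_list :: "'a list" where "zero_list = []"

definition plus_list :: "'a list \<Rightarrow> 'a list \<Rightarrow> 'a list" where "plus_list = (@)"

instance
  by standard (simp_all add: zero_list_def plus_list_def)

end

type_synonym ncpoly = "nat list \<Rightarrow>\<^sub>0 complex"

definition word_eval :: "(nat \<Rightarrow> ('a::complex_inner \<Rightarrow>\<^sub>L 'a)) \<Rightarrow> nat list \<Rightarrow> ('a \<Rightarrow>\<^sub>L 'a)" where
  "word_eval a w = foldr (\<lambda>i T. a i o\<^sub>L T) w id_blinfun"

definition nc_eval :: "ncpoly \<Rightarrow> (nat \<Rightarrow> ('a::complex_inner \<Rightarrow>\<^sub>L 'a)) \<Rightarrow> ('a \<Rightarrow>\<^sub>L 'a)" where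
  "nc_eval f a = (\<Sum>w \<in> Poly_Mapping.keys f. scaleC_op (Poly_Mapping.lookup f w) (word_eval a w))"

text \<open>
  Operators are substituted for all the infinitely many variables at once; only the finitely many
  that occur in \<open>f\<close> matter. The empty word evaluates to the identity operator, so for an algebra
  \<open>A\<close> not containing the identity this is the set of values \<open>f(A)\<close> only if \<open>f\<close> has zero constant
  term.
\<close>

definition nc_values :: "ncpoly \<Rightarrow> ('a::complex_inner \<Rightarrow>\<^sub>L 'a) set \<Rightarrow> ('a \<Rightarrow>\<^sub>L 'a) set" where
  "nc_values f A = {nc_eval f a | a. \<forall>i. a i \<in> A}"

text \<open>Evaluation is the unital algebra homomorphism sending each variable \<open>X\<^sub>i\<close> to \<open>a i\<close>.\<close>

lemma nc_eval_superset:
  assumes "finite W" "Poly_Mapping.keys f \<subseteq> W"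
  shows "nc_eval f a = (\<Sum>w\<in>W. scaleC_op (Poly_Mapping.lookup f w) (word_eval a w))"
  unfolding nc_eval_def
  by (rule sum.mono_neutral_left) (use assms in \<open>auto simp: in_keys_iff\<close>)

lemma nc_eval_single:
  "nc_eval (Poly_Mapping.single w c) a = scaleC_op c (word_eval a w)"
  by (simp add: nc_eval_def)

lemma nc_eval_var: "nc_eval (Poly_Mapping.single [i] 1) a = a i"
  by (simp add: nc_eval_single word_eval_def blinfun_eqI)

lemma nc_eval_one: "nc_eval 1 a = id_blinfun"
  using nc_eval_single[of 0 1 a] unfolding single_one
  by (simp add: word_eval_def zero_list_def)

lemma nc_eval_add: "nc_eval (f + g) a = nc_eval f a + nc_eval g a"
proof -
  let ?W = "Poly_Mapping.keys f \<union> Poly_Mapping.keys g"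
  have "nc_eval h a = (\<Sum>w\<in>?W. scaleC_op (Poly_Mapping.lookup h w) (word_eval a w))"
    if "h \<in> {f, g, f + g}" for h
    by (rule nc_eval_superset) (use that Poly_Mapping.keys_add[of f g] in auto)
  then show ?thesis
    by (simp add: lookup_add complex_op.scale_left_distrib sum.distrib)
qed

lemma word_eval_append: "word_eval a (v @ w) = word_eval a v o\<^sub>L word_eval a w"
  by (induction v) (auto simp: word_eval_def intro!: blinfun_eqI)

lemma word_eval_bounded_ops:
  "\<forall>i. a i \<in> bounded_ops \<Longrightarrow> word_eval a w \<in> bounded_ops"
  by (induction w) (auto simp: word_eval_def bounded_ops_def)

lemma nc_eval_mult:
  assumes a: "\<forall>i. a i \<in> bounded_ops"
  shows "nc_eval (f * g) a = nc_eval f a o\<^sub>L nc_eval g a"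
proof -
  have [simp]: "nc_eval 0 a = 0"
    by (simp add: nc_eval_def)
  have upd: "Poly_Mapping.update k v h = Poly_Mapping.single k v + h"
    if "k \<notin> Poly_Mapping.keys h" for k v and h :: ncpoly
    by (rule poly_mapping_eqI)
      (use that in \<open>auto simp: lookup_update lookup_add lookup_single in_keys_iff\<close>)
  have single: "nc_eval (Poly_Mapping.single v c * g) a =
      nc_eval (Poly_Mapping.single v c) a o\<^sub>L nc_eval g a" for v c
  proof (induction g rule: Poly_Mapping.update_induct)
    case (update h w d)
    have "nc_eval (Poly_Mapping.single v c * Poly_Mapping.single w d) a =
        nc_eval (Poly_Mapping.single v c) a o\<^sub>L nc_eval (Poly_Mapping.single w d) a"
      using word_eval_bounded_ops[OF a, of v]
      by (auto intro!: blinfun_eqI simp: mult_single nc_eval_single plus_list_def word_eval_append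
          scaleC_op.rep_eq bounded_ops_def scaleC_scaleC)
    with update show ?case
      by (simp add: upd distrib_left nc_eval_add
          bounded_bilinear.add_right[OF bounded_bilinear_blinfun_compose])
  qed simp
  show ?thesis
  proof (induction f rule: Poly_Mapping.update_induct)
    case (update h w d)
    then show ?case
      by (simp add: upd distrib_right nc_eval_add single
          bounded_bilinear.add_left[OF bounded_bilinear_blinfun_compose])
  qed simp
qed

end

theory Submission
  imports Defs
begin

text \<open>
  Write \<open>J\<close> for the algebra of all bounded or of all compact operators, and let \<open>w\<close> be a word of
  maximal length \<open>d \<ge> 1\<close> among the monomials of \<open>f\<close>. Substituting for the variable \<open>X\<^sub>i\<close> the sum of
  those new variables \<open>x\<^sub>j\<close> with \<open>w\<^sub>j = i\<close>, and taking alternating sums over sub-collections of the new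
  variables, retains only the monomials in which all of \<open>x\<^sub>0, \<dots>, x\<^bsub>d-1\<^esub>\<close> occur. As no monomial of \<open>f\<close>
  is longer than \<open>w\<close>, each of them occurs exactly once, and what remains is a multilinear polynomial
  \<open>g\<close> in which \<open>x\<^sub>0 \<dots> x\<^bsub>d-1\<^esub>\<close> has the nonzero coefficient of \<open>w\<close> (\<open>multilin_eq_polarization\<close>). The
  span of the values of \<open>f\<close> on \<open>J\<close> thus contains the span \<open>L\<close> of the values of \<open>g\<close>, and it suffices
  to prove \<open>J \<subseteq> L\<close>. The gain is that commutation with a fixed operator is a derivation, so \<open>L\<close> is
  stable under commutation with every bounded operator.

  Infinite dimension enters through a Cuntz pair, that is, two isometries with orthogonal ranges
  (\<open>ex_cuntz_pair\<close>); composing them gives isometries \<open>S\<^sub>0, S\<^sub>1, \<dots>\<close> with pairwise orthogonal ranges.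
  Substituting \<open>x\<^sub>j = S\<^sub>j b\<^sub>j S\<^bsub>j+1\<^esub>\<^sup>*\<close> kills every monomial of \<open>g\<close> except \<open>x\<^sub>0 \<dots> x\<^bsub>d-1\<^esub>\<close>, whose value is
  \<open>S\<^sub>0 b\<^sub>0 \<dots> b\<^bsub>d-1\<^esub> S\<^sub>d\<^sup>*\<close>. Since every element of \<open>J\<close> is a product of two elements of \<open>J\<close>
  (\<open>factorization\<close>), hence of \<open>d\<close> of them, \<open>L\<close> contains \<open>S\<^sub>0 a S\<^sub>d\<^sup>*\<close> and \<open>S\<^sub>d a S\<^sub>0\<^sup>*\<close> for all \<open>a \<in> J\<close>. The
  commutator of \<open>S\<^sub>0 a S\<^sub>d\<^sup>*\<close> and \<open>S\<^sub>d b S\<^sub>0\<^sup>*\<close>, compressed by \<open>S\<^sub>0\<close>, is \<open>a b\<close>, so Herstein's argument about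
  the ideal generated by the commutators of a Lie ideal (\<open>herstein\<close>) shows that \<open>L\<close> contains
  \<open>[a b, z]\<close>, and therefore \<open>[y, z]\<close>, for all \<open>y \<in> J\<close> and all bounded \<open>z\<close>.

  Finally, every \<open>a \<in> J\<close> is a sum of two such commutators (\<open>sum_of_commutators\<close>): if \<open>S\<close>, \<open>S'\<close> is the
  Cuntz pair, the map \<open>X \<mapsto> a + (S X S\<^sup>* + S' X S'\<^sup>*) / 2\<close> is a contraction of \<open>J\<close> with factor \<open>1/2\<close>,
  because an orthogonal direct sum of two copies of \<open>X\<close> has the norm of \<open>X\<close>. For its fixed point \<open>X\<close>
  the operator \<open>a\<close> is the average of \<open>X - S X S\<^sup>* = [X S\<^sup>*, S]\<close> and \<open>X - S' X S'\<^sup>* = [X S'\<^sup>*, S']\<close>.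

  The part after the construction of the Cuntz pair uses only that \<open>J\<close> is a closed two-sided ideal of
  the bounded operators with contractive approximate left units, which for the compact operators are
  the finite partial sums of an orthonormal expansion.
\<close>

section \<open>The inner product\<close>

instance chilbert_space \<subseteq> banach ..

lemma cinner_zero_left [simp]: "cinner 0 x = 0"
  using cinner_add_left[of 0 0 x] by simp

lemma cinner_minus_left: "cinner (- x) y = - cinner x (y :: 'a::complex_inner)"
  using cinner_add_left[of x "- x" y] by (simp add: add_eq_0_iff)

lemma cinner_diff_left: "cinner (x - y) z = cinner x z - cinner y (z :: 'a::complex_inner)"
  using cinner_add_left[of x "- y" z] by (simp add: cinner_minus_left)

lemma cinner_diff_right: "cinner x (y - z) = cinner x y - cinner x (z :: 'a::complex_inner)"
  by (metis cinner_diff_left cinner_commute complex_cnj_diff)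

lemma cinner_sum_left: "cinner (sum g F) y = (\<Sum>i\<in>F. cinner (g i) (y :: 'a::complex_inner))"
  by (induction F rule: infinite_finite_induct) (simp_all add: cinner_add_left)

section \<open>Orthonormal bases\<close>

definition orthonormal :: "'a::complex_inner set \<Rightarrow> bool" where
  "orthonormal B \<longleftrightarrow> (\<forall>x\<in>B. \<forall>y\<in>B. cinner x y = (if x = y then 1 else 0))"

text \<open>
  Completeness of an orthonormal family is stated through its orthogonal complement, which makes the
  coordinates of a vector determine it and lets operators be compared coordinate by coordinate.
\<close>

definition onb :: "'a::complex_inner set \<Rightarrow> bool" where
  "onb B \<longleftrightarrow> orthonormal B \<and> (\<forall>x. (\<forall>b\<in>B. cinner x b = 0) \<longrightarrow> x = 0)"

lemma onb_eqI: "onb B \<Longrightarrow> (\<And>b. b \<in> B \<Longrightarrow> cinner x b = cinner y b) \<Longrightarrow> x = y"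
  using cinner_diff_left[of x y] unfolding onb_def by (metis eq_iff_diff_eq_0)

lemma orthonormal_norm: "orthonormal B \<Longrightarrow> b \<in> B \<Longrightarrow> norm b = 1"
  using cinner_self_norm[of b] unfolding orthonormal_def
  by (metis norm_ge_zero of_real_1 of_real_eq_iff one_power2 power2_eq_iff_nonneg zero_le_one)

text \<open>
  A maximal orthonormal set has trivial orthogonal complement, since a nonzero vector in the
  complement could be normalized and added.
\<close>

lemma ex_onb: "\<exists>B :: 'a::complex_inner set. onb B"
proof -
  have "\<exists>M\<in>Collect orthonormal. \<forall>X\<in>Collect orthonormal. M \<subseteq> X \<longrightarrow> X = (M :: 'a set)"
  proof (rule subset_Zorn_nonempty)
    show "Collect orthonormal \<noteq> ({} :: 'a set set)"
      by (auto simp: orthonormal_def)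
  next
    fix C :: "'a set set" assume "subset.chain (Collect orthonormal) C"
    then have orth: "\<And>X. X \<in> C \<Longrightarrow> orthonormal X"
      and chain: "\<And>X Y. X \<in> C \<Longrightarrow> Y \<in> C \<Longrightarrow> X \<subseteq> Y \<or> Y \<subseteq> X"
      by (auto simp: subset_chain_def)
    show "\<Union>C \<in> Collect orthonormal"
      unfolding mem_Collect_eq orthonormal_def
    proof (intro ballI)
      fix x y assume "x \<in> \<Union>C" "y \<in> \<Union>C"
      then obtain X where "X \<in> C" "x \<in> X" "y \<in> X"
        using chain by blast
      with orth show "cinner x y = (if x = y then 1 else 0)"
        unfolding orthonormal_def by blast
    qed
  qed
  then obtain B :: "'a set" where B: "orthonormal B"
    and max: "\<And>X. orthonormal X \<Longrightarrow> B \<subseteq> X \<Longrightarrow> X = B"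
    by auto
  have "x = 0" if x: "\<forall>b\<in>B. cinner x b = 0" for x
  proof (rule ccontr)
    assume nz: "x \<noteq> 0"
    define u where "u = of_real (inverse (norm x)) *\<^sub>C x"
    have uu: "cinner u u = 1"
      using nz by (simp add: u_def norm_scaleC cinner_self_norm norm_inverse)
    have ub: "cinner u b = 0" if "b \<in> B" for b
      using x that by (simp add: u_def cinner_scaleC_left)
    have bu: "cinner b u = 0" if "b \<in> B" for b
      using ub[OF that] cinner_commute[of b u] by simp
    have "orthonormal (insert u B)"
      using B uu ub bu by (auto simp: orthonormal_def)
    from max[OF this] have "u \<in> B" by auto
    with ub uu show False by force
  qed
  with B show ?thesis
    unfolding onb_def by blast
qed

lemma cinner_orthonormal_sum:
  assumes "orthonormal B" "F \<subseteq> B" "finite F" "e \<in> B"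
  shows "cinner (\<Sum>b\<in>F. c b *\<^sub>C b) e = (if e \<in> F then c e else 0)"
proof -
  have "cinner (\<Sum>b\<in>F. c b *\<^sub>C b) e = (\<Sum>b\<in>F. if b = e then c b else 0)"
    unfolding cinner_sum_left cinner_scaleC_left
    by (rule sum.cong) (use assms in \<open>auto simp: orthonormal_def\<close>)
  with assms show ?thesis by simp
qed

lemma norm_orthonormal_sum:
  assumes "orthonormal B" "F \<subseteq> B" "finite F"
  shows "(norm (\<Sum>b\<in>F. c b *\<^sub>C b))\<^sup>2 = (\<Sum>b\<in>F. (cmod (c b))\<^sup>2)"
proof -
  let ?y = "\<Sum>b\<in>F. c b *\<^sub>C b"
  have "cinner ?y ?y = (\<Sum>b\<in>F. c b * cnj (cinner ?y b))"
    by (subst (1) cinner_sum_left) (simp add: cinner_scaleC_left flip: cinner_commute)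
  also have "\<dots> = (\<Sum>b\<in>F. c b * cnj (c b))"
    by (rule sum.cong) (use assms in \<open>auto simp: cinner_orthonormal_sum[OF assms]\<close>)
  also have "\<dots> = of_real (\<Sum>b\<in>F. (cmod (c b))\<^sup>2)"
    by (simp add: complex_norm_square del: of_real_power)
  finally show ?thesis
    unfolding cinner_self_norm of_real_eq_iff .
qed

text \<open>
  Pythagoras' theorem for the orthogonal projection onto the span of a finite orthonormal set.
\<close>

lemma norm_diff_orthonormal_projection:
  assumes "orthonormal B" "F \<subseteq> B" "finite F"
  shows "(norm (x - (\<Sum>b\<in>F. cinner x b *\<^sub>C b)))\<^sup>2 = (norm x)\<^sup>2 - (\<Sum>b\<in>F. (cmod (cinner x b))\<^sup>2)"
proof -
  define p where "p = (\<Sum>b\<in>F. cinner x b *\<^sub>C b)"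
  have px: "cinner p x = of_real (\<Sum>b\<in>F. (cmod (cinner x b))\<^sup>2)"
    unfolding p_def cinner_sum_left cinner_scaleC_left of_real_sum
    by (rule sum.cong)
      (auto simp: complex_norm_square cinner_commute[of _ x] simp del: of_real_power)
  have xp: "cinner x p = of_real (\<Sum>b\<in>F. (cmod (cinner x b))\<^sup>2)"
    using cinner_commute[of x p] by (simp only: px complex_cnj_complex_of_real)
  have pp: "cinner p p = of_real (\<Sum>b\<in>F. (cmod (cinner x b))\<^sup>2)"
    using norm_orthonormal_sum[OF assms, of "cinner x"] by (simp add: cinner_self_norm p_def)
  have "cinner (x - p) (x - p) = of_real ((norm x)\<^sup>2 - (\<Sum>b\<in>F. (cmod (cinner x b))\<^sup>2))"
    unfolding cinner_diff_left cinner_diff_right px xp pp by (simp add: cinner_self_norm)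
  then show ?thesis
    unfolding cinner_self_norm of_real_eq_iff p_def .
qed

lemma bessel:
  assumes "orthonormal B" "F \<subseteq> B" "finite F"
  shows "(\<Sum>b\<in>F. (cmod (cinner x b))\<^sup>2) \<le> (norm x)\<^sup>2"
  using norm_diff_orthonormal_projection[OF assms, of x]
    zero_le_power2[of "norm (x - (\<Sum>b\<in>F. cinner x b *\<^sub>C b))"] by linarith

lemma cmod_cinner_le: 
  assumes "norm b = 1" shows "cmod (cinner x b) \<le> norm x"
proof -
  have "orthonormal {b}"
    using assms by (simp add: orthonormal_def cinner_self_norm)
  from bessel[OF this order_refl, of x] show ?thesis
    by (simp add: power2_le_iff_abs_le)
qed

text \<open>
  Choosing finite sets on which the sum of squares comes close to its supremum makes the corresponding
  partial sums a Cauchy sequence: the squared distance of two of them is what each index set misses of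
  the union, hence small. A coefficient outside such a set is small for the same reason, so that the
  limit has the prescribed coordinates.
\<close>

lemma riesz_fischer:
  fixes B :: "'a::chilbert_space set"
  assumes B: "orthonormal B"
    and M: "\<And>F. finite F \<Longrightarrow> F \<subseteq> B \<Longrightarrow> (\<Sum>b\<in>F. (cmod (c b))\<^sup>2) \<le> M"
  shows "\<exists>y. (\<forall>b\<in>B. cinner y b = c b) \<and>
    (\<forall>e>0. \<exists>F. finite F \<and> F \<subseteq> B \<and> norm (y - (\<Sum>b\<in>F. c b *\<^sub>C b)) < e)"
proof -
  define q where "q F = (\<Sum>b\<in>F. (cmod (c b))\<^sup>2)" for F
  define s where "s = (SUP F\<in>{F. finite F \<and> F \<subseteq> B}. q F)"
  have bdd: "bdd_above (q ` {F. finite F \<and> F \<subseteq> B})"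
    using M by (auto simp: q_def bdd_above_def)
  have le_s: "q F \<le> s" if "finite F" "F \<subseteq> B" for F
    unfolding s_def using that bdd by (intro cSUP_upper) auto
  have "\<exists>F. finite F \<and> F \<subseteq> B \<and> s - inverse (real (Suc n)) < q F" for n
  proof -
    have "s - inverse (real (Suc n)) < s" by simp
    then show ?thesis
      unfolding s_def using bdd by (subst (asm) less_cSUP_iff) (auto simp: s_def)
  qed
  then obtain F where F: "\<And>n. finite (F n)" "\<And>n. F n \<subseteq> B"
    and s: "\<And>n. s - inverse (real (Suc n)) < q (F n)"
    by metis
  define y where "y n = (\<Sum>b\<in>F n. c b *\<^sub>C b)" for n
  have dist: "(norm (y n - y m))\<^sup>2 \<le> inverse (real (Suc n)) + inverse (real (Suc m))" for n m
  proof -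
    let ?U = "F n \<union> F m"
    let ?c = "\<lambda>k b. if b \<in> F k then c b else 0"
    have ext: "y k = (\<Sum>b\<in>?U. ?c k b *\<^sub>C b)" "q (F k) = (\<Sum>b\<in>?U. (cmod (?c k b))\<^sup>2)"
      if "k \<in> {n, m}" for k
      unfolding y_def q_def using that F by (auto intro!: sum.mono_neutral_cong_left)
    have "(norm (y n - y m))\<^sup>2 = (\<Sum>b\<in>?U. (cmod (?c n b - ?c m b))\<^sup>2)"
      using F by (simp only: ext insertI1 insertI2 norm_orthonormal_sum[OF B, symmetric]
          finite_Un Un_subset_iff sum_subtractf complex_vector.scale_left_diff_distrib)
    also have "\<dots> \<le> (\<Sum>b\<in>?U. ((cmod (c b))\<^sup>2 - (cmod (?c n b))\<^sup>2) + ((cmod (c b))\<^sup>2 - (cmod (?c m b))\<^sup>2))"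
      by (intro sum_mono) auto
    also have "\<dots> = (q ?U - q (F n)) + (q ?U - q (F m))"
      by (simp only: ext insertI1 insertI2 q_def[of ?U] sum.distrib sum_subtractf)
    also have "\<dots> \<le> (s - q (F n)) + (s - q (F m))"
      using le_s[of ?U] F by simp
    also have "\<dots> \<le> inverse (real (Suc n)) + inverse (real (Suc m))"
      using s[of n] s[of m] by linarith
    finally show ?thesis .
  qed
  have "Cauchy y"
  proof (rule CauchyI)
    fix e :: real assume "e > 0"
    then obtain N where N: "inverse (real (Suc N)) < e\<^sup>2 / 2"
      using reals_Archimedean[of "e\<^sup>2 / 2"] by auto
    have "norm (y n - y m) < e" if "n \<ge> N" "m \<ge> N" for n m
    proof -
      have "inverse (real (Suc k)) \<le> inverse (real (Suc N))" if "k \<ge> N" for k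
        using that by (simp add: le_imp_inverse_le)
      with dist[of n m] N that have "(norm (y n - y m))\<^sup>2 < e\<^sup>2"
        by (smt (verit) field_sum_of_halves)
      then show ?thesis
        using \<open>e > 0\<close> by (simp add: power_less_imp_less_base)
    qed
    then show "\<exists>N. \<forall>m\<ge>N. \<forall>n\<ge>N. norm (y m - y n) < e" by blast
  qed
  then obtain z where z: "y \<longlonglongrightarrow> z"
    using Cauchy_convergent_iff convergent_def by blast
  show ?thesis
  proof (intro exI[of _ z] conjI ballI allI impI)
    fix e :: real assume "e > 0"
    then have "\<forall>\<^sub>F n in sequentially. dist (y n) z < e"
      using z by (rule tendstoD[rotated])
    then obtain n where "dist (y n) z < e"
      using eventually_sequentially by auto
    then show "\<exists>F. finite F \<and> F \<subseteq> B \<and> norm (z - (\<Sum>b\<in>F. c b *\<^sub>C b)) < e"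
      using F[of n] by (metis y_def dist_commute dist_norm)
  next
    fix b assume b: "b \<in> B"
    have close: "(cmod (cinner (y n) b - c b))\<^sup>2 \<le> inverse (real (Suc n))" for n
    proof (cases "b \<in> F n")
      case True
      then show ?thesis
        using cinner_orthonormal_sum[OF B F(2,1) b] by (simp add: y_def)
    next
      case False
      then have "q (F n) + (cmod (c b))\<^sup>2 \<le> s"
        using le_s[of "insert b (F n)"] F b by (simp add: q_def)
      then show ?thesis
        using cinner_orthonormal_sum[OF B F(2,1) b, of c n] s[of n] False by (simp add: y_def)
    qed
    have "(\<lambda>n. (cmod (cinner (y n) b - c b))\<^sup>2) \<longlonglongrightarrow> 0"
      by (rule Lim_null_comparison[OF _ LIMSEQ_inverse_real_of_nat]) (use close in simp)
    then have "(\<lambda>n. cmod (cinner (y n) b - c b)) \<longlonglongrightarrow> 0"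
      using tendsto_real_sqrt[of "\<lambda>n. (cmod (cinner (y n) b - c b))\<^sup>2" 0] by simp
    then have 1: "(\<lambda>n. cinner (y n) b) \<longlonglongrightarrow> c b"
      by (simp add: tendsto_norm_zero_iff LIM_zero_iff)
    have "(\<lambda>n. norm (y n - z)) \<longlonglongrightarrow> 0"
      using z by (simp add: tendsto_norm_zero_iff LIM_zero_iff)
    then have "(\<lambda>n. cinner (y n - z) b) \<longlonglongrightarrow> 0"
      by (rule Lim_null_comparison[rotated])
        (simp add: cmod_cinner_le orthonormal_norm[OF B b])
    then have 2: "(\<lambda>n. cinner (y n) b) \<longlonglongrightarrow> cinner z b"
      by (simp add: cinner_diff_left LIM_zero_iff)
    show "cinner z b = c b"
      using 1 2 LIMSEQ_unique by blast
  qed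
qed

text \<open>
  The orthonormal expansion of \<open>x\<close> converges by Riesz--Fischer to a vector with the coordinates of
  \<open>x\<close>, and for a basis this vector is \<open>x\<close>.
\<close>

lemma onb_approx:
  fixes B :: "'a::chilbert_space set"
  assumes B: "onb B" and "e > 0"
  shows "\<exists>F. finite F \<and> F \<subseteq> B \<and> norm (x - (\<Sum>b\<in>F. cinner x b *\<^sub>C b)) < e"
proof -
  have o: "orthonormal B" using B by (simp add: onb_def)
  obtain y where y: "\<forall>b\<in>B. cinner y b = cinner x b"
    and app: "\<forall>e>0. \<exists>F. finite F \<and> F \<subseteq> B \<and> norm (y - (\<Sum>b\<in>F. cinner x b *\<^sub>C b)) < e"
    using riesz_fischer[OF o, of "cinner x" "(norm x)\<^sup>2"] bessel[OF o] by blast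
  have "y = x"
    using onb_eqI[OF B] y by blast
  with app \<open>e > 0\<close> show ?thesis by blast
qed

lemma onb_norm_le:
  fixes B :: "'a::chilbert_space set"
  assumes B: "onb B"
    and M: "\<And>F. finite F \<Longrightarrow> F \<subseteq> B \<Longrightarrow> (\<Sum>b\<in>F. (cmod (cinner y b))\<^sup>2) \<le> M"
  shows "(norm y)\<^sup>2 \<le> M"
proof (rule field_le_epsilon)
  fix e :: real assume "e > 0"
  then obtain F where F: "finite F" "F \<subseteq> B"
    "norm (y - (\<Sum>b\<in>F. cinner y b *\<^sub>C b)) < sqrt e"
    using onb_approx[OF B, of "sqrt e" y] by auto
  then have "(norm (y - (\<Sum>b\<in>F. cinner y b *\<^sub>C b)))\<^sup>2 \<le> e"
    using power_mono[OF less_imp_le[OF F(3)], of 2] \<open>e > 0\<close> by simp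
  with M[OF F(1,2)] norm_diff_orthonormal_projection[OF _ F(2,1), of y] B
  show "(norm y)\<^sup>2 \<le> M + e"
    by (simp add: onb_def)
qed

lemma onb_synthesis:
  fixes B :: "'a::chilbert_space set"
  assumes B: "onb B"
    and M: "\<And>F. finite F \<Longrightarrow> F \<subseteq> B \<Longrightarrow> (\<Sum>b\<in>F. (cmod (c b))\<^sup>2) \<le> M"
  shows "\<exists>y. (\<forall>b\<in>B. cinner y b = c b) \<and> (norm y)\<^sup>2 \<le> M"
proof -
  have "orthonormal B" using B by (simp add: onb_def)
  from riesz_fischer[OF this M] obtain y where y: "\<forall>b\<in>B. cinner y b = c b" by blast
  have "(norm y)\<^sup>2 \<le> M"
    by (rule onb_norm_le[OF B]) (use M y in \<open>simp add: subset_iff\<close>)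
  with y show ?thesis by blast
qed

lemma infinite_onb:
  assumes "\<nexists>B :: 'a::complex_inner set. finite B \<and> complex_vector.span B = UNIV"
    and B: "onb (B :: 'a set)"
  shows "infinite B"
proof
  assume fin: "finite B"
  have "x \<in> complex_vector.span B" for x
  proof -
    have "(\<Sum>b\<in>B. cinner x b *\<^sub>C b) = x"
      by (rule onb_eqI[OF B])
        (use B fin in \<open>simp add: onb_def cinner_orthonormal_sum[of B B]\<close>)
    moreover have "(\<Sum>b\<in>B. cinner x b *\<^sub>C b) \<in> complex_vector.span B"
      by (intro complex_vector.span_sum complex_vector.span_scale complex_vector.span_base)
    ultimately show ?thesis by simp
  qed
  with assms(1) fin show False by blast
qed

section \<open>Two isometries with orthogonal ranges\<close>

text \<open>
  An infinite set is equinumerous with the disjoint sum of two copies of itself.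
\<close>

lemma infinite_set_split:
  assumes "infinite B"
  obtains p q where "inj_on p B" "inj_on q B" "p ` B \<subseteq> B" "q ` B \<subseteq> B" "p ` B \<inter> q ` B = {}"
proof -
  obtain h where h: "bij_betw h (B <+> B) B"
    using card_of_Plus_infinite1[OF assms card_of_mono1[OF order_refl]]
    unfolding card_of_ordIso[symmetric] by blast
  then have inj: "inj_on h (B <+> B)" and im: "h ` (B <+> B) = B"
    by (auto simp: bij_betw_def)
  show thesis
  proof (rule that[of "h \<circ> Inl" "h \<circ> Inr"])
    show "(h \<circ> Inl) ` B \<inter> (h \<circ> Inr) ` B = {}"
      using inj by (auto simp: inj_on_def Plus_def)
    show "inj_on (h \<circ> Inl) B" "inj_on (h \<circ> Inr) B"
      using inj by (auto simp: inj_on_def Plus_def)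
    show "(h \<circ> Inl) ` B \<subseteq> B" "(h \<circ> Inr) ` B \<subseteq> B"
      using im by auto
  qed
qed

lemma sum_partial_reindex_le:
  fixes h :: "'b \<Rightarrow> real"
  assumes fin: "finite F" and "F \<subseteq> B" and p: "inj_on p B"
    and h: "\<And>c. c \<in> B \<Longrightarrow> h c \<ge> 0"
    and M: "\<And>G. finite G \<Longrightarrow> G \<subseteq> B \<Longrightarrow> sum h G \<le> M"
  shows "(\<Sum>c\<in>F. if c \<in> p ` B then h (the_inv_into B p c) else 0) \<le> M"
proof -
  let ?r = "the_inv_into B p" and ?E = "F \<inter> p ` B"
  have inj: "inj_on ?r ?E"
    using inj_on_the_inv_into[OF p] by (rule inj_on_subset) auto
  have "(\<Sum>c\<in>F. if c \<in> p ` B then h (?r c) else 0) = (\<Sum>c\<in>?E. h (?r c))"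
    using fin by (simp add: sum.inter_restrict)
  also have "\<dots> = sum h (?r ` ?E)"
    using inj by (simp add: sum.reindex)
  also have "\<dots> \<le> M"
    using fin the_inv_into_into[OF p] by (intro M) auto
  finally show ?thesis .
qed

text \<open>
  \<open>T\<close> and \<open>T'\<close> play the role of the adjoints of the isometries \<open>S\<close> and \<open>S'\<close>; the two norm conditions
  say that \<open>(u, v) \<mapsto> S u + S' v\<close> and \<open>x \<mapsto> (T x, T' x)\<close> are contractions between the Hilbert space and
  its orthogonal square.
\<close>

definition cuntz_pair ::
  "('a::complex_inner \<Rightarrow>\<^sub>L 'a) \<Rightarrow> ('a \<Rightarrow>\<^sub>L 'a) \<Rightarrow> ('a \<Rightarrow>\<^sub>L 'a) \<Rightarrow> ('a \<Rightarrow>\<^sub>L 'a) \<Rightarrow> bool" where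
  "cuntz_pair S T S' T' \<longleftrightarrow>
    {S, T, S', T'} \<subseteq> bounded_ops \<and>
    T o\<^sub>L S = id_blinfun \<and> T' o\<^sub>L S' = id_blinfun \<and> T o\<^sub>L S' = 0 \<and> T' o\<^sub>L S = 0 \<and>
    (\<forall>u v. (norm (S u + S' v))\<^sup>2 \<le> (norm u)\<^sup>2 + (norm v)\<^sup>2) \<and>
    (\<forall>x. (norm (T x))\<^sup>2 + (norm (T' x))\<^sup>2 \<le> (norm x)\<^sup>2)"

lemma bounded_op_of_coords:
  fixes B :: "'a::chilbert_space set" and T :: "'a \<Rightarrow> 'a"
  assumes B: "onb B"
    and add: "\<And>x y b. b \<in> B \<Longrightarrow> cinner (T (x + y)) b = cinner (T x) b + cinner (T y) b"
    and scale: "\<And>c x b. b \<in> B \<Longrightarrow> cinner (T (c *\<^sub>C x)) b = c * cinner (T x) b"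
    and norm: "\<And>x. norm (T x) \<le> norm x"
  shows "\<exists>U\<in>bounded_ops. blinfun_apply U = T"
proof -
  have s: "T (c *\<^sub>C x) = c *\<^sub>C T x" for c x
    by (rule onb_eqI[OF B]) (simp add: scale cinner_scaleC_left)
  have a: "T (x + y) = T x + T y" for x y
    by (rule onb_eqI[OF B]) (simp add: add cinner_add_left)
  have "bounded_linear T"
  proof (rule bounded_linear_intro[of _ 1])
    show "T (r *\<^sub>R x) = r *\<^sub>R T x" for r x
      by (metis s scaleC_of_real)
  qed (simp_all add: a norm)
  then have "blinfun_apply (Blinfun T) = T"
    by (rule bounded_linear_Blinfun_apply)
  with s show ?thesis
    unfolding bounded_ops_def by (intro bexI[of _ "Blinfun T"]) auto
qed

text \<open>
  Split an orthonormal basis \<open>B\<close> by injections \<open>p\<close>, \<open>q\<close> of \<open>B\<close> into itself with disjoint images. The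
  isometries send the basis vector \<open>b\<close> to \<open>p b\<close> and to \<open>q b\<close>. All operators are defined by their
  coordinates: the one of \<open>T x\<close> at \<open>b\<close> is that of \<open>x\<close> at \<open>p b\<close>, and the one of \<open>S u + S' v\<close> is that of
  \<open>u\<close> or \<open>v\<close>, read off along \<open>p\<close> or \<open>q\<close>.
\<close>

lemma ex_cuntz_pair:
  assumes "\<nexists>B :: 'a::chilbert_space set. finite B \<and> complex_vector.span B = UNIV"
  shows "\<exists>S T S' T' :: 'a \<Rightarrow>\<^sub>L 'a. cuntz_pair S T S' T'"
proof -
  obtain B :: "'a set" where B: "onb B"
    using ex_onb by blast
  then have o: "orthonormal B" by (simp add: onb_def)
  obtain p q where p: "inj_on p B" "p ` B \<subseteq> B" and q: "inj_on q B" "q ` B \<subseteq> B"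
    and pq: "p ` B \<inter> q ` B = {}"
    using infinite_set_split[OF infinite_onb[OF assms B]] .
  have "\<exists>y. (\<forall>b\<in>B. cinner y b = cinner x (r b)) \<and> (norm y)\<^sup>2 \<le> (norm x)\<^sup>2"
    if r: "inj_on r B" "r ` B \<subseteq> B" for r x
  proof (rule onb_synthesis[OF B])
    fix F assume F: "finite F" "F \<subseteq> B"
    have "(\<Sum>b\<in>F. (cmod (cinner x (r b)))\<^sup>2) = (\<Sum>b\<in>r ` F. (cmod (cinner x b))\<^sup>2)"
      using inj_on_subset[OF r(1) F(2)] by (simp add: sum.reindex)
    also have "\<dots> \<le> (norm x)\<^sup>2"
      using F r by (intro bessel[OF o]) auto
    finally show "(\<Sum>b\<in>F. (cmod (cinner x (r b)))\<^sup>2) \<le> (norm x)\<^sup>2" .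
  qed
  then have "\<exists>t. \<forall>x. (\<forall>b\<in>B. cinner (t x) b = cinner x (r b)) \<and> (norm (t x))\<^sup>2 \<le> (norm x)\<^sup>2"
    if "inj_on r B" "r ` B \<subseteq> B" for r
    using that by (intro choice) blast
  from this[OF p] this[OF q] obtain t t' where
    t: "\<And>x b. b \<in> B \<Longrightarrow> cinner (t x) b = cinner x (p b)" "\<And>x. (norm (t x))\<^sup>2 \<le> (norm x)\<^sup>2" and
    t': "\<And>x b. b \<in> B \<Longrightarrow> cinner (t' x) b = cinner x (q b)" "\<And>x. (norm (t' x))\<^sup>2 \<le> (norm x)\<^sup>2"
    by blast
  \<comment> \<open>the coordinates of \<open>S u + S' v\<close>; they vanish outside both images\<close>
  define coef where "coef u v c = (if c \<in> p ` B then cinner u (the_inv_into B p c) else 0) +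
    (if c \<in> q ` B then cinner v (the_inv_into B q c) else 0)" for u v c
  have "\<exists>y. (\<forall>b\<in>B. cinner y b = coef u v b) \<and> (norm y)\<^sup>2 \<le> (norm u)\<^sup>2 + (norm v)\<^sup>2" for u v
  proof (rule onb_synthesis[OF B])
    fix F assume F: "finite F" "F \<subseteq> B"
    have "(\<Sum>c\<in>F. (cmod (coef u v c))\<^sup>2) =
        (\<Sum>c\<in>F. if c \<in> p ` B then (cmod (cinner u (the_inv_into B p c)))\<^sup>2 else 0) +
        (\<Sum>c\<in>F. if c \<in> q ` B then (cmod (cinner v (the_inv_into B q c)))\<^sup>2 else 0)"
      unfolding sum.distrib[symmetric]
      by (rule sum.cong) (use pq in \<open>auto simp: coef_def\<close>)
    also have "\<dots> \<le> (norm u)\<^sup>2 + (norm v)\<^sup>2"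
      by (intro add_mono sum_partial_reindex_le F p q bessel[OF o]) auto
    finally show "(\<Sum>c\<in>F. (cmod (coef u v c))\<^sup>2) \<le> (norm u)\<^sup>2 + (norm v)\<^sup>2" .
  qed
  then obtain R where R: "\<And>u v b. b \<in> B \<Longrightarrow> cinner (R u v) b = coef u v b"
    "\<And>u v. (norm (R u v))\<^sup>2 \<le> (norm u)\<^sup>2 + (norm v)\<^sup>2"
    by metis
  have nle: "norm x \<le> norm y" if "(norm x)\<^sup>2 \<le> (norm y)\<^sup>2" for x y :: 'a
    using that by (simp add: power2_le_iff_abs_le)
  have "\<exists>T\<in>bounded_ops. blinfun_apply T = t" "\<exists>T\<in>bounded_ops. blinfun_apply T = t'"
    by (rule bounded_op_of_coords[OF B];
        use t t' nle in \<open>simp add: cinner_add_left cinner_scaleC_left\<close>)+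
  moreover have "\<exists>T\<in>bounded_ops. blinfun_apply T = (\<lambda>u. R u 0)"
    by (rule bounded_op_of_coords[OF B])
      (use R(2)[of _ 0] nle in \<open>auto simp: R(1) coef_def cinner_add_left cinner_scaleC_left\<close>)
  moreover have "\<exists>T\<in>bounded_ops. blinfun_apply T = R 0"
    by (rule bounded_op_of_coords[OF B])
      (use R(2)[of 0] nle in \<open>auto simp: R(1) coef_def cinner_add_left cinner_scaleC_left\<close>)
  ultimately obtain S T S' T' where mem: "{S, T, S', T'} \<subseteq> bounded_ops"
    and ap: "blinfun_apply S = (\<lambda>u. R u 0)" "blinfun_apply S' = R 0"
      "blinfun_apply T = t" "blinfun_apply T' = t'"
    by (metis empty_subsetI insert_subset)
  have coef_p: "coef u v (p b) = cinner u b" if "b \<in> B" for u v b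
    using that pq the_inv_into_f_f[OF p(1) that] by (auto simp: coef_def)
  have coef_q: "coef u v (q b) = cinner v b" if "b \<in> B" for u v b
    using that pq the_inv_into_f_f[OF q(1) that] by (auto simp: coef_def)
  have tR: "t (R u v) = u" "t' (R u v) = v" for u v
    by (rule onb_eqI[OF B]; use p q in \<open>auto simp: t t' R coef_p coef_q image_subset_iff\<close>)+
  have sum: "S u + S' v = R u v" for u v
    by (rule onb_eqI[OF B]) (auto simp: ap R coef_def cinner_add_left)
  have "(norm (t x))\<^sup>2 + (norm (t' x))\<^sup>2 \<le> (norm x)\<^sup>2" for x
  proof -
    have fin: "(\<Sum>b\<in>F. (cmod (cinner (t x) b))\<^sup>2) + (\<Sum>b\<in>G. (cmod (cinner (t' x) b))\<^sup>2) \<le> (norm x)\<^sup>2"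
      if F: "finite F" "F \<subseteq> B" and G: "finite G" "G \<subseteq> B" for F G
    proof -
      have "(\<Sum>b\<in>F. (cmod (cinner (t x) b))\<^sup>2) = (\<Sum>b\<in>p ` F. (cmod (cinner x b))\<^sup>2)"
        using F t(1) inj_on_subset[OF p(1) F(2)] by (auto simp: sum.reindex intro!: sum.cong)
      moreover have "(\<Sum>b\<in>G. (cmod (cinner (t' x) b))\<^sup>2) = (\<Sum>b\<in>q ` G. (cmod (cinner x b))\<^sup>2)"
        using G t'(1) inj_on_subset[OF q(1) G(2)] by (auto simp: sum.reindex intro!: sum.cong)
      moreover have "p ` F \<inter> q ` G = {}" using pq F G by blast
      ultimately have "(\<Sum>b\<in>F. (cmod (cinner (t x) b))\<^sup>2) + (\<Sum>b\<in>G. (cmod (cinner (t' x) b))\<^sup>2) =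
          (\<Sum>b\<in>p ` F \<union> q ` G. (cmod (cinner x b))\<^sup>2)"
        using F G by (simp add: sum.union_disjoint)
      also have "\<dots> \<le> (norm x)\<^sup>2"
        using F G p(2) q(2) by (intro bessel[OF o]) blast+
      finally show ?thesis .
    qed
    \<comment> \<open>passing to the supremum over the two finite sets one after the other\<close>
    have "(norm (t x))\<^sup>2 \<le> (norm x)\<^sup>2 - (\<Sum>b\<in>G. (cmod (cinner (t' x) b))\<^sup>2)"
      if G: "finite G" "G \<subseteq> B" for G
      using fin[OF _ _ G] by (intro onb_norm_le[OF B]) (simp add: le_diff_eq)
    then have "(norm (t' x))\<^sup>2 \<le> (norm x)\<^sup>2 - (norm (t x))\<^sup>2"
      by (intro onb_norm_le[OF B]) (simp add: le_diff_eq add.commute)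
    then show ?thesis by simp
  qed
  then have "cuntz_pair S T S' T'"
    unfolding cuntz_pair_def sum
    using mem R(2) tR by (auto simp: ap intro!: blinfun_eqI)
  then show ?thesis by blast
qed

section \<open>Compact operators\<close>

lemma bounded_ops_subspace: "complex_op.subspace bounded_ops"
  by (rule complex_op.subspaceI)
    (auto simp: bounded_ops_def blinfun.add_left scaleC_add_right scaleC_op.rep_eq scaleC_scaleC
      mult.commute)

lemma bounded_ops_compose: "T \<in> bounded_ops \<Longrightarrow> U \<in> bounded_ops \<Longrightarrow> T o\<^sub>L U \<in> bounded_ops"
  by (simp add: bounded_ops_def)

lemma id_bounded_ops: "id_blinfun \<in> bounded_ops"
  by (simp add: bounded_ops_def)

lemma closed_bounded_ops: "closed bounded_ops"
proof -
  have "closed {T :: 'a \<Rightarrow>\<^sub>L 'a. T (c *\<^sub>C x) = c *\<^sub>C T x}" for c x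
    by (intro closed_Collect_eq bounded_linear.continuous_on[OF bounded_linear_scaleC]
        continuous_intros)
  then have "closed (\<Inter>c. \<Inter>x. {T :: 'a \<Rightarrow>\<^sub>L 'a. T (c *\<^sub>C x) = c *\<^sub>C T x})"
    by blast
  moreover have "(\<Inter>c. \<Inter>x. {T :: 'a \<Rightarrow>\<^sub>L 'a. T (c *\<^sub>C x) = c *\<^sub>C T x}) = bounded_ops"
    by (auto simp: bounded_ops_def)
  ultimately show ?thesis by simp
qed

lemma compact_closure_subset:
  fixes A :: "'a::metric_space set"
  assumes "A \<subseteq> K" "compact K" shows "compact (closure A)"
  using assms by (metis closure_minimal compact_Int_closed compact_imp_closed closed_closure
      inf.absorb_iff2)

lemma compact_opsI:
  assumes "T \<in> bounded_ops" "\<And>S. bounded S \<Longrightarrow> \<exists>K. compact K \<and> blinfun_apply T ` S \<subseteq> K"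
  shows "T \<in> compact_ops"
  using assms compact_closure_subset unfolding compact_ops_def by blast

lemma compact_ops_bounded_ops: "compact_ops \<subseteq> bounded_ops"
  by (auto simp: compact_ops_def)

lemma compact_ops_compose_left:
  assumes T: "T \<in> compact_ops" and U: "U \<in> bounded_ops"
  shows "U o\<^sub>L T \<in> compact_ops"
proof (rule compact_opsI)
  show "U o\<^sub>L T \<in> bounded_ops"
    using T U by (simp add: bounded_ops_compose compact_ops_def)
  fix S :: "'a set" assume "bounded S"
  with T have "compact (blinfun_apply U ` closure (blinfun_apply T ` S))"
    by (intro compact_continuous_image continuous_intros) (auto simp: compact_ops_def)
  moreover have "blinfun_apply (U o\<^sub>L T) ` S \<subseteq> blinfun_apply U ` closure (blinfun_apply T ` S)"
    using closure_subset by fastforce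
  ultimately show "\<exists>K. compact K \<and> blinfun_apply (U o\<^sub>L T) ` S \<subseteq> K" by blast
qed

lemma compact_ops_compose_right:
  assumes T: "T \<in> compact_ops" and U: "U \<in> bounded_ops"
  shows "T o\<^sub>L U \<in> compact_ops"
proof -
  have "blinfun_apply (T o\<^sub>L U) ` S = blinfun_apply T ` blinfun_apply U ` S" for S
    by (auto simp: image_image)
  then show ?thesis
    using T U bounded_linear_image[OF _ blinfun.bounded_linear_right, of _ U]
    by (simp add: compact_ops_def bounded_ops_compose)
qed

lemma compact_ops_subspace: "complex_op.subspace compact_ops"
proof (rule complex_op.subspaceI)
  show "0 \<in> (compact_ops :: ('a \<Rightarrow>\<^sub>L 'a) set)"
  proof (rule compact_opsI)
    show "0 \<in> bounded_ops"
      by (rule complex_op.subspace_0[OF bounded_ops_subspace])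
    show "\<exists>K. compact K \<and> blinfun_apply 0 ` S \<subseteq> K" for S :: "'a set"
      by (intro exI[of _ "{0}"]) auto
  qed
next
  fix T U :: "'a \<Rightarrow>\<^sub>L 'a" assume TU: "T \<in> compact_ops" "U \<in> compact_ops"
  show "T + U \<in> compact_ops"
  proof (rule compact_opsI)
    show "T + U \<in> bounded_ops"
      using TU complex_op.subspace_add[OF bounded_ops_subspace] compact_ops_bounded_ops by blast
    fix S :: "'a set" assume S: "bounded S"
    let ?K = "{x + y |x y. x \<in> closure (blinfun_apply T ` S) \<and> y \<in> closure (blinfun_apply U ` S)}"
    have "compact ?K"
      using TU S by (intro compact_sums) (auto simp: compact_ops_def)
    moreover have "blinfun_apply (T + U) ` S \<subseteq> ?K"
    proof (rule image_subsetI)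
      fix x assume "x \<in> S"
      then have "T x \<in> closure (blinfun_apply T ` S)" "U x \<in> closure (blinfun_apply U ` S)"
        by (auto intro: closure_subset[THEN subsetD])
      then show "blinfun_apply (T + U) x \<in> ?K"
        unfolding blinfun.add_left by blast
    qed
    ultimately show "\<exists>K. compact K \<and> blinfun_apply (T + U) ` S \<subseteq> K" by blast
  qed
next
  fix c and T :: "'a \<Rightarrow>\<^sub>L 'a" assume T: "T \<in> compact_ops"
  have "scaleC_op c T = scaleC_op c id_blinfun o\<^sub>L T"
    by (auto intro!: blinfun_eqI simp: scaleC_op.rep_eq)
  also have "\<dots> \<in> compact_ops"
    by (intro compact_ops_compose_left T complex_op.subspace_scale bounded_ops_subspace
        id_bounded_ops)
  finally show "scaleC_op c T \<in> compact_ops" .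
qed

lemma compact_ops_finite_net:
  assumes "T \<in> compact_ops" "e > 0"
  shows "\<exists>k. finite k \<and> (\<forall>x. norm x \<le> 1 \<longrightarrow> (\<exists>y\<in>k. norm (T x - y) < e))"
proof -
  have "compact (closure (blinfun_apply T ` cball 0 1))"
    using assms by (auto simp: compact_ops_def)
  then obtain k where k: "finite k" "closure (blinfun_apply T ` cball 0 1) \<subseteq> (\<Union>y\<in>k. ball y e)"
    using \<open>e > 0\<close> unfolding compact_eq_totally_bounded by blast
  have "\<exists>y\<in>k. norm (T x - y) < e" if "norm x \<le> 1" for x
  proof -
    have "T x \<in> (\<Union>y\<in>k. ball y e)"
      using k(2) closure_subset[of "blinfun_apply T ` cball 0 1"] that by fastforce
    then show ?thesis by (auto simp: dist_norm norm_minus_commute)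
  qed
  with k(1) show ?thesis by blast
qed

text \<open>
  It is enough to test total boundedness on the unit ball, as the image of any other bounded set is
  contained in a multiple of its image.
\<close>

lemma compact_ops_of_finite_nets:
  fixes T :: "'a::chilbert_space \<Rightarrow>\<^sub>L 'a"
  assumes T: "T \<in> bounded_ops"
    and net: "\<And>e. e > 0 \<Longrightarrow> \<exists>k. finite k \<and> (\<forall>x. norm x \<le> 1 \<longrightarrow> (\<exists>y\<in>k. norm (T x - y) < e))"
  shows "T \<in> compact_ops"
proof (rule compact_opsI[OF T])
  fix S :: "'a set" assume "bounded S"
  then obtain r where r: "r > 0" "\<And>x. x \<in> S \<Longrightarrow> norm x \<le> r"
    unfolding bounded_pos by blast
  have "compact (closure (blinfun_apply T ` S))"
    unfolding compact_eq_totally_bounded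
  proof (intro conjI allI impI)
    show "complete (closure (blinfun_apply T ` S))"
      by (simp add: complete_eq_closed)
    fix e :: real assume "e > 0"
    with r have "e / 2 / r > 0" by simp
    from net[OF this] obtain k where k: "finite k"
      and near: "\<And>x. norm x \<le> 1 \<Longrightarrow> \<exists>y\<in>k. norm (T x - y) < e / 2 / r" by blast
    have sub: "\<exists>y\<in>(*\<^sub>R) r ` k. norm (T x - y) < e / 2" if "x \<in> S" for x
    proof -
      have "norm ((1 / r) *\<^sub>R x) \<le> 1"
        using r that by (simp add: divide_simps)
      from near[OF this] obtain y where y: "y \<in> k" "norm (T ((1 / r) *\<^sub>R x) - y) < e / 2 / r"
        by blast
      have "T x - r *\<^sub>R y = r *\<^sub>R (T ((1 / r) *\<^sub>R x) - y)"
        using r by (simp add: blinfun.scaleR_right scaleR_diff_right)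
      then have "norm (T x - r *\<^sub>R y) = r * norm (T ((1 / r) *\<^sub>R x) - y)"
        using r by simp
      also have "\<dots> < e / 2"
        using y(2) r by (simp add: field_simps)
      finally show ?thesis using y(1) by blast
    qed
    have "blinfun_apply T ` S \<subseteq> (\<Union>y\<in>(*\<^sub>R) r ` k. cball y (e / 2))"
    proof (rule image_subsetI)
      fix x assume "x \<in> S"
      from sub[OF this] obtain y where "y \<in> (*\<^sub>R) r ` k" "norm (T x - y) < e / 2" ..
      then show "T x \<in> (\<Union>y\<in>(*\<^sub>R) r ` k. cball y (e / 2))"
        by (intro UN_I[of y]) (simp_all add: dist_norm norm_minus_commute)
    qed
    then have "closure (blinfun_apply T ` S) \<subseteq> (\<Union>y\<in>(*\<^sub>R) r ` k. cball y (e / 2))"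
      using k by (intro closure_minimal closed_UN) auto
    also have "\<dots> \<subseteq> (\<Union>y\<in>(*\<^sub>R) r ` k. ball y e)"
      using \<open>e > 0\<close> by (intro UN_mono) (auto simp: dist_norm)
    finally show "\<exists>k. finite k \<and> closure (blinfun_apply T ` S) \<subseteq> (\<Union>y\<in>k. ball y e)"
      using k by blast
  qed
  then show "\<exists>K. compact K \<and> blinfun_apply T ` S \<subseteq> K"
    by (intro exI[of _ "closure (blinfun_apply T ` S)"]) (simp add: closure_subset)
qed

text \<open>
  A finite net for the image of the unit ball under an approximating operator is one for the limit,
  with a slightly larger radius.
\<close>

lemma closed_compact_ops: "closed (compact_ops :: ('a::chilbert_space \<Rightarrow>\<^sub>L 'a) set)"
  unfolding closed_sequential_limits
proof (intro allI impI, elim conjE)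
  fix X and T :: "'a \<Rightarrow>\<^sub>L 'a"
  assume X: "\<forall>n. X n \<in> compact_ops" and lim: "X \<longlonglongrightarrow> T"
  show "T \<in> compact_ops"
  proof (rule compact_ops_of_finite_nets)
    show "T \<in> bounded_ops"
      using X lim closed_bounded_ops compact_ops_bounded_ops
      unfolding closed_sequential_limits by blast
    fix e :: real assume e: "e > 0"
    then obtain n where n: "norm (X n - T) < e / 2"
      using LIMSEQ_D[OF lim, of "e / 2"] by auto
    obtain k where k: "finite k" "\<And>x. norm x \<le> 1 \<Longrightarrow> \<exists>y\<in>k. norm (X n x - y) < e / 2"
      using compact_ops_finite_net[of "X n" "e / 2"] X e by auto
    have "\<exists>y\<in>k. norm (T x - y) < e" if x: "norm x \<le> 1" for x
    proof -
      obtain y where y: "y \<in> k" "norm (X n x - y) < e / 2"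
        using k(2)[OF x] by blast
      have "norm (X n x - T x) \<le> norm (X n - T) * norm x"
        by (metis blinfun.diff_left norm_blinfun)
      also have "\<dots> \<le> norm (X n - T)"
        using x by (simp add: mult_left_le)
      finally have "norm (X n x - T x) < e / 2"
        using n by simp
      with y(2) have "norm ((X n x - y) - (X n x - T x)) < e"
        by (smt (verit) field_sum_of_halves norm_triangle_ineq4)
      with y(1) show ?thesis by auto
    qed
    with k(1) show "\<exists>k. finite k \<and> (\<forall>x. norm x \<le> 1 \<longrightarrow> (\<exists>y\<in>k. norm (T x - y) < e))" by blast
  qed
qed

lemma rank_one_compact:
  assumes "norm b = 1"
  shows "\<exists>T\<in>compact_ops. \<forall>x. blinfun_apply T x = cinner x b *\<^sub>C (b :: 'a::complex_inner)"
proof -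
  have "bounded_linear (\<lambda>x. cinner x b *\<^sub>C b)"
  proof (rule bounded_linear_intro[of _ 1])
    show "cinner (r *\<^sub>R x) b *\<^sub>C b = r *\<^sub>R (cinner x b *\<^sub>C b)" for r x
      by (simp add: cinner_scaleC_left scaleC_scaleC flip: scaleC_of_real)
    show "norm (cinner x b *\<^sub>C b) \<le> norm x * 1" for x
      using cmod_cinner_le[OF assms] by (simp add: norm_scaleC assms)
  qed (simp add: cinner_add_left scaleC_add_left)
  then obtain T where T: "\<And>x. blinfun_apply T x = cinner x b *\<^sub>C b"
    using bounded_linear_Blinfun_apply by metis
  have "T \<in> compact_ops"
  proof (rule compact_opsI)
    show "T \<in> bounded_ops"
      by (simp add: bounded_ops_def T cinner_scaleC_left scaleC_scaleC)
    fix S :: "'a set" assume "bounded S"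
    then obtain r where r: "\<And>x. x \<in> S \<Longrightarrow> norm x \<le> r"
      unfolding bounded_iff by blast
    have "continuous_on UNIV (\<lambda>c. c *\<^sub>C b)"
    proof (rule linear_continuous_on)
      show "bounded_linear (\<lambda>c. c *\<^sub>C b)"
        by (rule bounded_linear_intro[of _ "norm b"])
          (auto simp: norm_scaleC scaleC_add_left scaleC_scaleC scaleR_conv_of_real
            simp flip: scaleC_of_real)
    qed
    then have "compact ((\<lambda>c. c *\<^sub>C b) ` cball 0 r)"
      by (intro compact_continuous_image compact_cball) (rule continuous_on_subset, auto)
    moreover have "blinfun_apply T ` S \<subseteq> (\<lambda>c. c *\<^sub>C b) ` cball 0 r"
      using r cmod_cinner_le[OF assms] by (force simp: T intro: order_trans)
    ultimately show "\<exists>K. compact K \<and> blinfun_apply T ` S \<subseteq> K" by blast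
  qed
  with T show ?thesis by blast
qed

text \<open>
  The unit is the orthogonal projection \<open>p\<close> onto the span of finitely many basis vectors, chosen so
  that \<open>p\<close> moves the points of a finite net for the image of the unit ball only slightly. Since
  \<open>1 - p\<close> is a contraction, it is small on the whole image.
\<close>

lemma compact_ops_approx_unit:
  fixes a :: "'a::chilbert_space \<Rightarrow>\<^sub>L 'a"
  assumes a: "a \<in> compact_ops" and e: "e > 0"
  shows "\<exists>p\<in>compact_ops. norm p \<le> 1 \<and> norm (a - (p o\<^sub>L a)) \<le> e"
proof -
  obtain B :: "'a set" where B: "onb B"
    using ex_onb by blast
  then have o: "orthonormal B" by (simp add: onb_def)
  obtain k where k: "finite k" "\<And>x. norm x \<le> 1 \<Longrightarrow> \<exists>y\<in>k. norm (a x - y) < e / 2"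
    using compact_ops_finite_net[OF a, of "e / 2"] e by auto
  define P where "P F x = (\<Sum>b\<in>F. cinner x b *\<^sub>C b)" for F and x :: 'a
  have contr: "norm (x - P F x) \<le> norm x" if "finite F" "F \<subseteq> B" for F x
  proof -
    have "(norm (x - P F x))\<^sup>2 \<le> (norm x)\<^sup>2"
      unfolding P_def norm_diff_orthonormal_projection[OF o that(2,1)] by (simp add: sum_nonneg)
    then show ?thesis by (simp add: power2_le_iff_abs_le)
  qed
  have mono: "norm (x - P G x) \<le> norm (x - P F x)" if "finite G" "F \<subseteq> G" "G \<subseteq> B" for F G x
  proof -
    have "(\<Sum>b\<in>F. (cmod (cinner x b))\<^sup>2) \<le> (\<Sum>b\<in>G. (cmod (cinner x b))\<^sup>2)"
      using that by (intro sum_mono2) auto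
    then have "(norm (x - P G x))\<^sup>2 \<le> (norm (x - P F x))\<^sup>2"
      using that finite_subset[OF that(2,1)]
      by (simp add: P_def norm_diff_orthonormal_projection[OF o])
    then show ?thesis by (simp add: power2_le_iff_abs_le)
  qed
  have "\<exists>F. finite F \<and> F \<subseteq> B \<and> norm (y - P F y) < e / 2" for y
    unfolding P_def using onb_approx[OF B, of "e / 2"] e by simp
  then obtain F where F: "\<And>y. finite (F y)" "\<And>y. F y \<subseteq> B" "\<And>y. norm (y - P (F y) y) < e / 2"
    by metis
  define G where "G = (\<Union>y\<in>k. F y)"
  have G: "finite G" "G \<subseteq> B"
    using F k(1) by (auto simp: G_def)
  have Gk: "norm (y - P G y) < e / 2" if "y \<in> k" for y
    using mono[OF G(1), of "F y" y] F(3)[of y] that G(2) by (force simp: G_def)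
  have "\<forall>b\<in>B. \<exists>T\<in>compact_ops. \<forall>x. blinfun_apply T x = cinner x b *\<^sub>C b"
    using rank_one_compact orthonormal_norm[OF o] by blast
  then obtain E where E: "\<And>b. b \<in> B \<Longrightarrow> E b \<in> compact_ops"
    "\<And>b x. b \<in> B \<Longrightarrow> blinfun_apply (E b) x = cinner x b *\<^sub>C b"
    by metis
  define p where "p = (\<Sum>b\<in>G. E b)"
  have p: "p x = P G x" for x
    using E(2) G(2) by (auto simp: p_def P_def blinfun.sum_left intro!: sum.cong)
  have "p \<in> compact_ops"
    unfolding p_def using E(1) G(2) by (intro complex_op.subspace_sum[OF compact_ops_subspace]) auto
  moreover have "norm p \<le> 1"
  proof (rule norm_blinfun_bound)
    fix x
    have "(norm (p x))\<^sup>2 \<le> (norm x)\<^sup>2"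
      using bessel[OF o G(2,1), of x] norm_orthonormal_sum[OF o G(2,1), of "cinner x"]
      by (simp add: p P_def)
    then show "norm (p x) \<le> 1 * norm x"
      by (simp add: power2_le_iff_abs_le)
  qed simp
  moreover have "norm (a - (p o\<^sub>L a)) \<le> e"
  proof (rule norm_blinfun_bound)
    show "0 \<le> e" using e by simp
    have unit: "norm ((a - (p o\<^sub>L a)) x) \<le> e" if x: "norm x \<le> 1" for x
    proof -
      obtain y where y: "y \<in> k" "norm (a x - y) < e / 2"
        using k(2)[OF x] by blast
      have "norm ((a x - y) - p (a x - y)) \<le> norm (a x - y)"
        unfolding p by (rule contr[OF G])
      moreover have "norm (a x - p (a x)) = norm (((a x - y) - p (a x - y)) + (y - p y))"
        by (simp add: blinfun.diff_right)
      ultimately have "norm (a x - p (a x)) \<le> e"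
        using y(2) Gk[OF y(1)] norm_triangle_ineq[of "(a x - y) - p (a x - y)" "y - p y"]
        unfolding p by linarith
      then show ?thesis by (simp add: blinfun.diff_left)
    qed
    show "norm ((a - (p o\<^sub>L a)) x) \<le> e * norm x" for x
    proof (cases "x = 0")
      case False
      have "norm ((a - (p o\<^sub>L a)) ((1 / norm x) *\<^sub>R x)) \<le> e"
        using False by (intro unit) simp
      with False show ?thesis
        by (simp add: blinfun.scaleR_right divide_simps)
    qed simp
  qed
  ultimately show ?thesis by blast
qed

section \<open>Commutators and factorizations in operator ideals\<close>

definition op_comm :: "('a::real_normed_vector \<Rightarrow>\<^sub>L 'a) \<Rightarrow> ('a \<Rightarrow>\<^sub>L 'a) \<Rightarrow> ('a \<Rightarrow>\<^sub>L 'a)" where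
  "op_comm x y = (x o\<^sub>L y) - (y o\<^sub>L x)"

lemma op_comm_apply: "op_comm x y v = x (y v) - y (x v)"
  by (simp add: op_comm_def blinfun.diff_left)

lemma scaleR_eq_scaleC_op: "r *\<^sub>R T = scaleC_op (of_real r) T"
  by (rule blinfun_eqI) (simp add: scaleC_op.rep_eq scaleC_of_real blinfun.scaleR_left)

lemma cuntz_pairD:
  assumes "cuntz_pair S T S' T'"
  shows "S \<in> bounded_ops" "T \<in> bounded_ops" "S' \<in> bounded_ops" "T' \<in> bounded_ops"
    "\<And>x. T (S x) = x" "\<And>x. T' (S' x) = x" "\<And>x. T (S' x) = 0" "\<And>x. T' (S x) = 0"
    "\<And>u v. (norm (S u + S' v))\<^sup>2 \<le> (norm u)\<^sup>2 + (norm v)\<^sup>2"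
    "\<And>x. (norm (T x))\<^sup>2 + (norm (T' x))\<^sup>2 \<le> (norm x)\<^sup>2"
  using assms unfolding cuntz_pair_def
  by (auto dest: arg_cong[where f = blinfun_apply] simp: fun_eq_iff)

lemma cuntz_pair_norm_le:
  assumes "cuntz_pair S T S' T'"
  shows "norm S \<le> 1" "norm T \<le> 1" "norm S' \<le> 1" "norm T' \<le> 1"
proof -
  note c = cuntz_pairD[OF assms]
  have le: "norm x \<le> 1 * norm y" if "(norm x)\<^sup>2 \<le> (norm y)\<^sup>2" for x y :: 'a
    using that by (simp add: power2_le_iff_abs_le)
  show "norm S \<le> 1" using c(9)[of _ 0] by (intro norm_blinfun_bound le) auto
  show "norm S' \<le> 1" using c(9)[of 0] by (intro norm_blinfun_bound le) auto
  show "norm T \<le> 1"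
    by (intro norm_blinfun_bound le order_trans[OF _ c(10)]) auto
  show "norm T' \<le> 1"
    by (intro norm_blinfun_bound le order_trans[OF _ c(10)]) auto
qed

text \<open>
  The operator in question is the orthogonal direct sum of two copies of \<open>Y\<close>. That its norm does not
  exceed that of \<open>Y\<close>, instead of twice this number, is what makes the map in \<open>sum_of_commutators\<close> a
  contraction.
\<close>

lemma norm_direct_sum_le:
  assumes c: "cuntz_pair S T S' T'"
  shows "norm ((S o\<^sub>L Y o\<^sub>L T) + (S' o\<^sub>L Y o\<^sub>L T')) \<le> norm Y"
proof (rule norm_blinfun_bound)
  fix x
  have Y: "(norm (Y z))\<^sup>2 \<le> (norm Y)\<^sup>2 * (norm z)\<^sup>2" for z
    using power_mono[OF norm_blinfun[of Y z] norm_ge_zero, of 2] by (simp add: power_mult_distrib)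
  have "(norm (S (Y (T x)) + S' (Y (T' x))))\<^sup>2 \<le> (norm (Y (T x)))\<^sup>2 + (norm (Y (T' x)))\<^sup>2"
    by (rule cuntz_pairD[OF c])
  also have "\<dots> \<le> (norm Y)\<^sup>2 * ((norm (T x))\<^sup>2 + (norm (T' x))\<^sup>2)"
    using add_mono[OF Y[of "T x"] Y[of "T' x"]] by (simp add: distrib_left)
  also have "\<dots> \<le> (norm Y)\<^sup>2 * (norm x)\<^sup>2"
    by (intro mult_left_mono cuntz_pairD[OF c]) simp
  finally have "(norm (S (Y (T x)) + S' (Y (T' x))))\<^sup>2 \<le> (norm Y * norm x)\<^sup>2"
    by (simp add: power_mult_distrib)
  then show "norm (((S o\<^sub>L Y o\<^sub>L T) + (S' o\<^sub>L Y o\<^sub>L T')) x) \<le> norm Y * norm x"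
    by (simp add: blinfun.add_left power2_le_iff_abs_le)
qed simp

text \<open>
  Iterating one isometry of a Cuntz pair before applying the other yields infinitely many isometries
  \<open>S'\<^sup>n S\<close> with pairwise orthogonal ranges; their adjoints are \<open>T T'\<^sup>n\<close>.
\<close>

definition branch :: "('a::real_normed_vector \<Rightarrow>\<^sub>L 'a) \<Rightarrow> ('a \<Rightarrow>\<^sub>L 'a) \<Rightarrow> nat \<Rightarrow> ('a \<Rightarrow>\<^sub>L 'a)" where
  "branch S S' n = (((o\<^sub>L) S') ^^ n) S"

definition cobranch :: "('a::real_normed_vector \<Rightarrow>\<^sub>L 'a) \<Rightarrow> ('a \<Rightarrow>\<^sub>L 'a) \<Rightarrow> nat \<Rightarrow> ('a \<Rightarrow>\<^sub>L 'a)" where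
  "cobranch T T' n = ((\<lambda>U. U o\<^sub>L T') ^^ n) T"

lemma branch_simps:
  "branch S S' 0 = S" "branch S S' (Suc n) = S' o\<^sub>L branch S S' n"
  "cobranch T T' 0 = T" "cobranch T T' (Suc n) = cobranch T T' n o\<^sub>L T'"
  by (simp_all add: branch_def cobranch_def)

lemma cobranch_branch:
  assumes c: "cuntz_pair S T S' T'"
  shows "cobranch T T' m (branch S S' n x) = (if m = n then x else 0)"
proof (induction m arbitrary: n)
  case 0
  then show ?case by (cases n) (simp_all add: branch_simps cuntz_pairD[OF c])
next
  case (Suc m)
  then show ?case by (cases n) (simp_all add: branch_simps cuntz_pairD[OF c])
qed

lemma branch_bounded_ops:
  assumes c: "cuntz_pair S T S' T'"
  shows "branch S S' n \<in> bounded_ops" "cobranch T T' n \<in> bounded_ops"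
  by (induction n)
    (use cuntz_pairD(1-4)[OF c] in \<open>simp_all add: branch_simps bounded_ops_def\<close>)

lemma norm_compose_le_one: "norm x \<le> 1 \<Longrightarrow> norm y \<le> 1 \<Longrightarrow> norm (x o\<^sub>L y) \<le> 1"
  using norm_blinfun_compose[of x y] mult_mono[of "norm x" 1 "norm y" 1] by simp

lemma branch_norm_le:
  assumes c: "cuntz_pair S T S' T'"
  shows "norm (branch S S' n) \<le> 1" "norm (cobranch T T' n) \<le> 1"
  by (induction n)
    (use cuntz_pair_norm_le[OF c] in \<open>simp_all add: branch_simps norm_compose_le_one\<close>)

lemma word_eval_cong: "(\<And>i. i \<in> set w \<Longrightarrow> x i = y i) \<Longrightarrow> word_eval x w = word_eval y w"
  by (induction w) (simp_all add: word_eval_def)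

lemma word_eval_Nil: "word_eval x [] = id_blinfun"
  by (simp add: word_eval_def)

lemma word_eval_Cons: "word_eval x (i # w) = x i o\<^sub>L word_eval x w"
  by (simp add: word_eval_def)

text \<open>
  The properties shared by the algebra of bounded operators and that of compact operators that the
  argument needs. The approximate units are what makes factorization possible.
\<close>

locale approx_unital_ideal =
  fixes J :: "('a::chilbert_space \<Rightarrow>\<^sub>L 'a) set"
  assumes subspace: "complex_op.subspace J"
    and bounded: "J \<subseteq> bounded_ops"
    and closed: "closed J"
    and left: "\<And>x y. x \<in> bounded_ops \<Longrightarrow> y \<in> J \<Longrightarrow> x o\<^sub>L y \<in> J"
    and right: "\<And>x y. x \<in> J \<Longrightarrow> y \<in> bounded_ops \<Longrightarrow> x o\<^sub>L y \<in> J"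
    and approx_unit: "\<And>a e. a \<in> J \<Longrightarrow> e > 0 \<Longrightarrow> \<exists>p\<in>J. norm p \<le> 1 \<and> norm (a - (p o\<^sub>L a)) \<le> e"
begin

lemma scaleR_mem: "x \<in> J \<Longrightarrow> r *\<^sub>R x \<in> J"
  unfolding scaleR_eq_scaleC_op by (rule complex_op.subspace_scale[OF subspace])

lemma suminf_mem:
  assumes "\<And>n. g n \<in> J" "summable g" shows "suminf g \<in> J"
proof (rule closed_sequentially[OF closed])
  show "(\<lambda>n. sum g {..<n}) \<longlonglongrightarrow> suminf g"
    using assms(2) by (rule summable_LIMSEQ)
  show "sum g {..<n} \<in> J" for n
    using assms(1) by (intro complex_op.subspace_sum[OF subspace])
qed

text \<open>
  The fixed point equation \<open>X = a + (S X T + S' X T') / 2\<close> expresses \<open>a\<close> through the differences of \<open>X\<close>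
  and its copies \<open>S X T\<close> and \<open>S' X T'\<close>. Such a difference is a commutator, for instance
  \<open>(X T) S - S (X T)\<close>. Using \<open>S\<close> as one of the entries is the reason for commutators with arbitrary
  bounded operators, since \<open>S\<close> is not in \<open>J\<close> when \<open>J\<close> consists of compact operators.
\<close>

lemma sum_of_commutators:
  assumes c: "cuntz_pair S T S' T'" and a: "a \<in> J"
  shows "\<exists>y\<in>J. \<exists>z\<in>J. a = op_comm y S + op_comm z S'"
proof -
  note cs = cuntz_pairD[OF c]
  define \<Phi> where "\<Phi> X = a + (1/2) *\<^sub>R ((S o\<^sub>L X o\<^sub>L T) + (S' o\<^sub>L X o\<^sub>L T'))" for X
  have "\<exists>!X. X \<in> J \<and> \<Phi> X = X"
  proof (rule Banach_fix[of J "1/2"])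
    show "complete J" using closed by (simp add: complete_eq_closed)
    show "J \<noteq> {}" using a by blast
    show "\<Phi> ` J \<subseteq> J"
      unfolding \<Phi>_def image_subset_iff
      by (intro ballI complex_op.subspace_add[OF subspace] scaleR_mem a right[OF left] cs(1-4))
    show "dist (\<Phi> X) (\<Phi> Y) \<le> 1/2 * dist X Y" for X Y
    proof -
      have "\<Phi> X - \<Phi> Y = (1/2) *\<^sub>R ((S o\<^sub>L (X - Y) o\<^sub>L T) + (S' o\<^sub>L (X - Y) o\<^sub>L T'))"
        by (rule blinfun_eqI) (simp add: \<Phi>_def blinfun.bilinear_simps algebra_simps)
      then show ?thesis
        using norm_direct_sum_le[OF c, of "X - Y"] by (simp add: dist_norm)
    qed
  qed simp_all
  then obtain X where X: "X \<in> J" and fp: "\<Phi> X = X" by blast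
  have "X v = a v + (1/2) *\<^sub>R (S (X (T v)) + S' (X (T' v)))" for v
    by (subst fp[symmetric]) (simp add: \<Phi>_def blinfun.bilinear_simps)
  then have "a v = X v - (1/2) *\<^sub>R (S (X (T v)) + S' (X (T' v)))" for v
    by (metis add_diff_cancel_right')
  then have "a = op_comm ((1/2) *\<^sub>R (X o\<^sub>L T)) S + op_comm ((1/2) *\<^sub>R (X o\<^sub>L T')) S'"
    by (intro blinfun_eqI)
      (simp add: op_comm_apply blinfun.bilinear_simps cs scaleR_add_right flip: scaleR_left_distrib)
  moreover have "(1/2) *\<^sub>R (X o\<^sub>L T) \<in> J" "(1/2) *\<^sub>R (X o\<^sub>L T') \<in> J"
    using X cs(2,4) by (auto intro: scaleR_mem right)
  ultimately show ?thesis by blast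
qed

text \<open>
  Starting with \<open>a\<close>, split off \<open>p\<^sub>n r\<^sub>n\<close> from the remainder \<open>r\<^sub>n\<close>, where the approximate unit \<open>p\<^sub>n\<close> is chosen
  such that the remainders decrease like \<open>4\<^sup>-\<^sup>n\<close>; then \<open>a\<close> is the sum of all \<open>p\<^sub>n r\<^sub>n\<close>. The isometries
  \<open>S\<^sub>n\<close> with orthogonal ranges and their adjoints \<open>T\<^sub>n\<close> gather this sum into a single product of
  \<open>\<Sum> 2\<^sup>-\<^sup>n p\<^sub>n T\<^sub>n\<close> and \<open>\<Sum> 2\<^sup>n S\<^sub>n r\<^sub>n\<close>: the weights make both series converge in norm, and mixed terms vanish.
\<close>

lemma factorization:
  fixes S T S' T' :: "'a \<Rightarrow>\<^sub>L 'a"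
  assumes c: "cuntz_pair S T S' T'" and a: "a \<in> J"
  shows "\<exists>b\<in>J. \<exists>c\<in>J. a = b o\<^sub>L c"
proof -
  \<comment> \<open>the summand 1 keeps the bound on the remainders positive when \<open>a = 0\<close>\<close>
  define C where "C = norm a + 1"
  have C: "C > 0" by (simp add: C_def add_nonneg_pos)
  let ?S = "branch S S'" and ?T = "cobranch T T'"
  have "\<exists>r. \<forall>n. (r n \<in> J \<and> norm (r n) \<le> C / 4 ^ n \<and> (n = 0 \<longrightarrow> r n = a)) \<and>
      (\<exists>p\<in>J. norm p \<le> 1 \<and> r (Suc n) = r n - (p o\<^sub>L r n))"
  proof (rule dependent_nat_choice)
    show "\<exists>x. x \<in> J \<and> norm x \<le> C / 4 ^ 0 \<and> (0 = 0 \<longrightarrow> x = a)"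
      using a by (auto simp: C_def)
    fix x n assume x: "x \<in> J \<and> norm x \<le> C / 4 ^ n \<and> (n = 0 \<longrightarrow> x = a)"
    then obtain p where p: "p \<in> J" "norm p \<le> 1" "norm (x - (p o\<^sub>L x)) \<le> C / 4 ^ Suc n"
      using approx_unit[of x "C / 4 ^ Suc n"] C by auto
    moreover have "x - (p o\<^sub>L x) \<in> J"
      using x p(1) bounded by (intro complex_op.subspace_diff[OF subspace] left) auto
    ultimately show "\<exists>y. (y \<in> J \<and> norm y \<le> C / 4 ^ Suc n \<and> (Suc n = 0 \<longrightarrow> y = a)) \<and>
        (\<exists>p\<in>J. norm p \<le> 1 \<and> y = x - (p o\<^sub>L x))"
      by blast
  qed
  then obtain r where r: "\<And>n. r n \<in> J" "\<And>n. norm (r n) \<le> C / 4 ^ n" "r 0 = a"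
    and "\<forall>n. \<exists>p\<in>J. norm p \<le> 1 \<and> r (Suc n) = r n - (p o\<^sub>L r n)"
    by blast
  then obtain p where p: "\<And>n. p n \<in> J" "\<And>n. norm (p n) \<le> 1"
    and r_Suc: "\<And>n. r (Suc n) = r n - (p n o\<^sub>L r n)"
    by metis
  define b where "b n = (1/2) ^ n *\<^sub>R (p n o\<^sub>L ?T n)" for n
  define e where "e n = 2 ^ n *\<^sub>R (?S n o\<^sub>L r n)" for n
  have geo: "summable (\<lambda>n. M * (1/2) ^ n)" for M :: real
    by (intro summable_mult summable_geometric) simp
  have sb: "summable b"
  proof (rule summable_comparison_test'[OF geo[of 1]])
    show "norm (b n) \<le> 1 * (1/2) ^ n" for n
      using norm_compose_le_one[OF p(2) branch_norm_le(2)[OF c], of n n] by (simp add: b_def)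
  qed
  have se: "summable e"
  proof (rule summable_comparison_test'[OF geo[of C]])
    show "norm (e n) \<le> C * (1/2) ^ n" for n
    proof -
      have "norm (?S n o\<^sub>L r n) \<le> norm (?S n) * norm (r n)"
        by (rule norm_blinfun_compose)
      also have "\<dots> \<le> 1 * (C / 4 ^ n)"
        by (intro mult_mono branch_norm_le[OF c] r) auto
      finally have "2 ^ n * norm (?S n o\<^sub>L r n) \<le> 2 ^ n * (1 * (C / 4 ^ n))"
        by (rule mult_left_mono) simp
      then have "norm (e n) \<le> 2 ^ n * (C / 4 ^ n)"
        by (simp add: e_def)
      also have "\<dots> = C * (1/2) ^ n"
        using power_mult_distrib[of "2 :: real" 2 n] by (simp add: power_divide)
      finally show ?thesis .
    qed
  qed
  have bJ: "suminf b \<in> J"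
    by (rule suminf_mem[OF _ sb]) (simp add: b_def scaleR_mem right p branch_bounded_ops[OF c])
  have eJ: "suminf e \<in> J"
    by (rule suminf_mem[OF _ se]) (simp add: e_def scaleR_mem left r branch_bounded_ops[OF c])
  have Te: "?T n o\<^sub>L suminf e = 2 ^ n *\<^sub>R r n" for n
  proof -
    have "(\<lambda>m. ?T n o\<^sub>L e m) = (\<lambda>m. if m = n then 2 ^ m *\<^sub>R r m else 0)"
      by (auto simp: fun_eq_iff e_def blinfun.bilinear_simps cobranch_branch[OF c]
          intro!: blinfun_eqI)
    then have "(\<lambda>m. ?T n o\<^sub>L e m) sums (2 ^ n *\<^sub>R r n)"
      using sums_single[of n "\<lambda>m. 2 ^ m *\<^sub>R r m"] by simp
    moreover have "(\<lambda>m. ?T n o\<^sub>L e m) sums (?T n o\<^sub>L suminf e)"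
      by (intro bounded_linear.sums[OF bounded_bilinear.bounded_linear_right[OF
              bounded_bilinear_blinfun_compose]] summable_sums se)
    ultimately show ?thesis by (rule sums_unique2[rotated])
  qed
  have "(\<lambda>n. b n o\<^sub>L suminf e) sums (suminf b o\<^sub>L suminf e)"
    by (intro bounded_linear.sums[OF bounded_bilinear.bounded_linear_left[OF
            bounded_bilinear_blinfun_compose]] summable_sums sb)
  moreover have "b n o\<^sub>L suminf e = r n - r (Suc n)" for n
  proof -
    have "b n o\<^sub>L suminf e = (1/2) ^ n *\<^sub>R (p n o\<^sub>L (?T n o\<^sub>L suminf e))"
      by (rule blinfun_eqI) (simp add: b_def blinfun.bilinear_simps)
    also have "\<dots> = p n o\<^sub>L r n"
      unfolding Te by (rule blinfun_eqI) (simp add: blinfun.bilinear_simps power_divide)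
    finally show ?thesis by (simp add: r_Suc)
  qed
  moreover have "(\<lambda>n. r n - r (Suc n)) sums (r 0 - 0)"
  proof (rule telescope_sums')
    show "r \<longlonglongrightarrow> 0"
    proof (rule Lim_null_comparison[of _ "\<lambda>n. C * (1/4) ^ n"])
      show "\<forall>\<^sub>F n in sequentially. norm (r n) \<le> C * (1/4) ^ n"
        using r(2) by (simp add: power_divide)
      show "(\<lambda>n. C * (1/4) ^ n) \<longlonglongrightarrow> 0"
        by (intro tendsto_mult_right_zero LIMSEQ_realpow_zero) auto
    qed
  qed
  ultimately have "suminf b o\<^sub>L suminf e = a"
    using r(3) by (auto dest: sums_unique2)
  with bJ eJ show ?thesis by blast
qed

lemma multiple_factorization:
  fixes S T S' T' :: "'a \<Rightarrow>\<^sub>L 'a"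
  assumes c: "cuntz_pair S T S' T'" and a: "a \<in> J" and "d > 0"
  shows "\<exists>b. (\<forall>j. b j \<in> J) \<and> word_eval b [0..<d] = a"
  using \<open>d > 0\<close> a
proof (induction d arbitrary: a rule: nat_induct_non_zero)
  case 1
  then show ?case
    by (intro exI[of _ "\<lambda>_. a"]) (auto simp: word_eval_Nil word_eval_Cons intro!: blinfun_eqI)
next
  case (Suc d)
  obtain u v where uv: "u \<in> J" "v \<in> J" "a = u o\<^sub>L v"
    using factorization[OF c Suc.prems] by blast
  obtain b where b: "\<forall>j. b j \<in> J" "word_eval b [0..<d] = u"
    using Suc.IH[OF uv(1)] by blast
  have u: "word_eval (b(d := v)) [0..<d] = u"
    using b(2) word_eval_cong[of "[0..<d]" "b(d := v)" b] by simp
  have "word_eval (b(d := v)) [0..<Suc d] = u o\<^sub>L v"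
    unfolding upt_Suc_append[OF le0] word_eval_append u
    by (auto simp: word_eval_Nil word_eval_Cons intro!: blinfun_eqI)
  then have "word_eval (b(d := v)) [0..<Suc d] = a"
    unfolding uv(3) .
  moreover have "\<forall>j. (b(d := v)) j \<in> J"
    using b uv by simp
  ultimately show ?case by blast
qed

end

section \<open>The multilinear part of a polynomial\<close>

lemma scaleC_op_compose_left: "scaleC_op c x o\<^sub>L y = scaleC_op c (x o\<^sub>L y)"
  by (rule blinfun_eqI) (simp add: scaleC_op.rep_eq)

lemma scaleC_op_compose_right: "x \<in> bounded_ops \<Longrightarrow> x o\<^sub>L scaleC_op c y = scaleC_op c (x o\<^sub>L y)"
  by (rule blinfun_eqI) (simp add: scaleC_op.rep_eq bounded_ops_def)

lemmas compose_sum_left = bounded_bilinear.sum_left[OF bounded_bilinear_blinfun_compose]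
lemmas compose_sum_right = bounded_bilinear.sum_right[OF bounded_bilinear_blinfun_compose]

lemma op_comm_zero [simp]: "op_comm 0 y = 0"
  by (rule blinfun_eqI) (simp add: op_comm_apply)

lemma op_comm_add: "op_comm (x + x') y = op_comm x y + op_comm x' y"
  by (rule blinfun_eqI) (simp add: op_comm_apply blinfun.bilinear_simps)

lemma op_comm_sum: "op_comm (sum g F) y = (\<Sum>i\<in>F. op_comm (g i) y)"
  by (induction F rule: infinite_finite_induct) (simp_all add: op_comm_add)

lemma op_comm_scaleC: "y \<in> bounded_ops \<Longrightarrow> op_comm (scaleC_op c x) y = scaleC_op c (op_comm x y)"
  by (simp add: op_comm_def scaleC_op_compose_left scaleC_op_compose_right
      complex_op.scale_right_diff_distrib)

definition perm_words :: "nat \<Rightarrow> nat list set" where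
  "perm_words d = {t. distinct t \<and> set t = {..<d}}"

definition multilin ::
  "(nat list \<Rightarrow> complex) \<Rightarrow> nat \<Rightarrow> (nat \<Rightarrow> ('a::complex_inner \<Rightarrow>\<^sub>L 'a)) \<Rightarrow> ('a \<Rightarrow>\<^sub>L 'a)" where
  "multilin c d x = (\<Sum>t\<in>perm_words d. scaleC_op (c t) (word_eval x t))"

text \<open>
  The Leibniz rule; distinctness of the letters allows each application of the derivation to be
  expressed by changing one of the operators that are substituted.
\<close>

lemma op_comm_word_eval:
  assumes "distinct t"
  shows "op_comm (word_eval x t) y = (\<Sum>k\<in>set t. word_eval (x(k := op_comm (x k) y)) t)"
  using assms
proof (induction t)
  case Nil
  show ?case by (auto simp: word_eval_Nil op_comm_apply intro!: blinfun_eqI)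
next
  case (Cons i t)
  have IH: "op_comm (word_eval x t) y = (\<Sum>k\<in>set t. word_eval (x(k := op_comm (x k) y)) t)"
    by (rule Cons.IH) (use Cons.prems in \<open>simp\<close>)
  have "op_comm (word_eval x (i # t)) y =
      (op_comm (x i) y o\<^sub>L word_eval x t) + (x i o\<^sub>L op_comm (word_eval x t) y)"
    by (rule blinfun_eqI) (simp add: op_comm_apply blinfun.bilinear_simps word_eval_Cons)
  also have "op_comm (x i) y o\<^sub>L word_eval x t = word_eval (x(i := op_comm (x i) y)) (i # t)"
  proof -
    have "word_eval (x(i := op_comm (x i) y)) t = word_eval x t"
      by (rule word_eval_cong) (use Cons.prems in \<open>auto\<close>)
    then show ?thesis by (simp add: word_eval_Cons)
  qed
  also have "x i o\<^sub>L op_comm (word_eval x t) y =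
      (\<Sum>k\<in>set t. x i o\<^sub>L word_eval (x(k := op_comm (x k) y)) t)"
    unfolding IH compose_sum_right ..
  also have "\<dots> = (\<Sum>k\<in>set t. word_eval (x(k := op_comm (x k) y)) (i # t))"
    using Cons.prems by (intro sum.cong) (auto simp: word_eval_Cons)
  also have "word_eval (x(i := op_comm (x i) y)) (i # t) +
      (\<Sum>k\<in>set t. word_eval (x(k := op_comm (x k) y)) (i # t)) =
      (\<Sum>k\<in>set (i # t). word_eval (x(k := op_comm (x k) y)) (i # t))"
    using Cons.prems by (simp del: fun_upd_apply)
  finally show ?case .
qed

lemma op_comm_multilin:
  assumes "y \<in> bounded_ops"
  shows "op_comm (multilin c d x) y = (\<Sum>k<d. multilin c d (x(k := op_comm (x k) y)))"
proof -
  have "op_comm (multilin c d x) y =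
      (\<Sum>t\<in>perm_words d. scaleC_op (c t) (\<Sum>k<d. word_eval (x(k := op_comm (x k) y)) t))"
    unfolding multilin_def op_comm_sum op_comm_scaleC[OF assms]
    by (rule sum.cong) (auto simp: op_comm_word_eval perm_words_def)
  also have "\<dots> = (\<Sum>k<d. multilin c d (x(k := op_comm (x k) y)))"
    unfolding multilin_def complex_op.scale_sum_right by (rule sum.swap)
  finally show ?thesis .
qed

subsection \<open>Chains\<close>

text \<open>
  The only permutation of \<open>0, \<dots>, d-1\<close> in which each letter is followed by its successor is the identity.
  Therefore operators that can only be composed in consecutive order isolate one coefficient of a
  multilinear polynomial.
\<close>

definition consecutive :: "nat \<Rightarrow> nat \<Rightarrow> bool" where
  "consecutive i j \<longleftrightarrow> j = Suc i"

text \<open>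
  The operator with index \<open>j\<close> maps between the ranges of two of the orthogonal isometries, with indices
  \<open>p (j + 1)\<close> and \<open>p j\<close>, so a product vanishes unless adjacent indices match. The relabelling \<open>p\<close> serves
  to choose where a chain begins and ends.
\<close>

lemma word_eval_chain:
  assumes c: "cuntz_pair S T S' T'" and p: "inj p" and "t \<noteq> []"
  shows "word_eval (\<lambda>j. branch S S' (p j) o\<^sub>L b j o\<^sub>L cobranch T T' (p (Suc j))) t =
    (if successively consecutive t
     then branch S S' (p (hd t)) o\<^sub>L word_eval b t o\<^sub>L cobranch T T' (p (Suc (last t))) else 0)"
  using \<open>t \<noteq> []\<close>
proof (induction t rule: list_nonempty_induct)
  case (single i)
  show ?case by (auto simp: word_eval_Cons word_eval_Nil intro!: blinfun_eqI)
next
  case (cons i t)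
  let ?S = "branch S S'" and ?T = "cobranch T T'"
  let ?x = "\<lambda>j. ?S (p j) o\<^sub>L b j o\<^sub>L ?T (p (Suc j))"
  have succ: "successively consecutive (i # t) \<longleftrightarrow>
      hd t = Suc i \<and> successively consecutive t"
    using cons.hyps by (simp add: successively_Cons consecutive_def[of i])
  show ?case
  proof (rule blinfun_eqI)
    fix v
    have "word_eval ?x (i # t) v = ?S (p i) (b i (?T (p (Suc i)) (word_eval ?x t v)))"
      by (simp add: word_eval_Cons)
    also have "word_eval ?x t v = (if successively consecutive t
        then ?S (p (hd t)) (word_eval b t (?T (p (Suc (last t))) v)) else 0)"
      unfolding cons.IH by simp
    also have "?T (p (Suc i)) \<dots> = (if successively consecutive (i # t)
        then word_eval b t (?T (p (Suc (last t))) v) else 0)"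
      unfolding succ by (auto simp: cobranch_branch[OF c] inj_eq[OF p])
    finally show "word_eval ?x (i # t) v = (if successively consecutive (i # t)
        then ?S (p (hd (i # t))) o\<^sub>L word_eval b (i # t) o\<^sub>L ?T (p (Suc (last (i # t)))) else 0) v"
      using cons.hyps by (simp add: word_eval_Cons)
  qed
qed

lemma successive_perm_word:
  assumes "t \<in> perm_words d" "successively consecutive t"
  shows "t = [0..<d]"
proof -
  have "successively (<) t"
    by (rule successively_mono[OF assms(2)]) (simp add: consecutive_def)
  then have "sorted_wrt (<) t"
    using successively_iff_sorted_wrt_strong[of t "(<)"] by force
  moreover have "set t = set [0..<d]"
    using assms(1) unfolding perm_words_def by (simp add: lessThan_atLeast0)
  ultimately show ?thesis
    using strict_sorted_equal[of "[0..<d]" t] by simp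
qed

lemma finite_perm_words: "finite (perm_words d)"
proof (rule finite_subset)
  show "perm_words d \<subseteq> {t. set t \<subseteq> {..<d} \<and> length t = d}"
    using distinct_card by (fastforce simp: perm_words_def)
  show "finite {t. set t \<subseteq> {..<d} \<and> length t = d}"
    by (rule finite_lists_length_eq) simp
qed

lemma multilin_chain:
  assumes c: "cuntz_pair S T S' T'" and p: "inj p" and "d > 0"
  shows "multilin c d (\<lambda>j. branch S S' (p j) o\<^sub>L b j o\<^sub>L cobranch T T' (p (Suc j))) =
    scaleC_op (c [0..<d]) (branch S S' (p 0) o\<^sub>L word_eval b [0..<d] o\<^sub>L cobranch T T' (p d))"
proof -
  let ?x = "\<lambda>j. branch S S' (p j) o\<^sub>L b j o\<^sub>L cobranch T T' (p (Suc j))"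
  have mem: "[0..<d] \<in> perm_words d" by (auto simp: perm_words_def)
  have succ: "successively consecutive [0..<d]"
    by (simp add: successively_conv_nth consecutive_def)
  have "word_eval ?x t = 0" if "t \<in> perm_words d - {[0..<d]}" for t
  proof -
    have "set t = {..<d}"
      using that by (simp add: perm_words_def)
    then have "t \<noteq> []"
      using \<open>d > 0\<close> by (metis empty_set lessThan_iff empty_iff)
    moreover have "\<not> successively consecutive t"
      using successive_perm_word[of t d] that by (metis DiffD1 DiffD2 singletonI)
    ultimately show ?thesis by (simp add: word_eval_chain[OF c p])
  qed
  then have "multilin c d ?x = (\<Sum>t\<in>{[0..<d]}. scaleC_op (c t) (word_eval ?x t))"
    unfolding multilin_def using mem finite_perm_words
    by (intro sum.mono_neutral_right) auto
  also have "\<dots> = scaleC_op (c [0..<d]) (word_eval ?x [0..<d])"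
    by simp
  also have "word_eval ?x [0..<d] =
      branch S S' (p 0) o\<^sub>L word_eval b [0..<d] o\<^sub>L cobranch T T' (p d)"
    using succ \<open>d > 0\<close> by (subst word_eval_chain[OF c p]) auto
  finally show ?thesis by simp
qed

subsection \<open>Polarization\<close>

lemma alternating_sum_Pow:
  assumes "finite X"
  shows "(\<Sum>A\<in>Pow X. (- 1) ^ card A) = (if X = {} then 1 else 0 :: complex)"
  using assms
proof (induction X rule: finite_induct)
  case (insert e X)
  have "(\<Sum>A\<in>Pow (insert e X). (- 1) ^ card A) =
      (\<Sum>A\<in>Pow X. (- 1) ^ card A) + (\<Sum>A\<in>insert e ` Pow X. (- 1) ^ card A :: complex)"
    unfolding Pow_insert using insert by (intro sum.union_disjoint) auto
  also have "(\<Sum>A\<in>insert e ` Pow X. (- 1) ^ card A :: complex) = (\<Sum>A\<in>Pow X. (- 1) ^ card (insert e A))"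
    using insert by (subst sum.reindex) (auto simp: inj_on_def)
  also have "\<dots> = (\<Sum>A\<in>Pow X. - ((- 1) ^ card A))"
    using insert by (intro sum.cong) (auto simp: card_insert_if finite_subset)
  finally show ?case by (simp add: sum_negf)
qed simp

text \<open>
  Inclusion--exclusion: passing from \<open>A\<close> to \<open>D - A\<close> gives the alternating sum over all subsets of \<open>D - E\<close>.
\<close>

lemma alternating_sum_supersets:
  assumes D: "finite D" and E: "E \<subseteq> D"
  shows "(\<Sum>A\<in>Pow D. if E \<subseteq> A then (- 1) ^ card (D - A) else 0) = (if E = D then 1 else 0 :: complex)"
proof -
  have "(\<Sum>A\<in>Pow D. if E \<subseteq> A then (- 1) ^ card (D - A) else 0 :: complex) =
      (\<Sum>A\<in>{A \<in> Pow D. E \<subseteq> A}. (- 1) ^ card (D - A))"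
    by (rule sum.inter_filter[symmetric]) (use D in \<open>simp\<close>)
  also have "\<dots> = (\<Sum>A\<in>Pow (D - E). (- 1) ^ card A)"
    by (rule sum.reindex_bij_witness[of _ "\<lambda>A. D - A" "\<lambda>A. D - A"])
      (use E in \<open>auto simp: double_diff\<close>)
  also have "\<dots> = (if E = D then 1 else 0)"
    using D E by (subst alternating_sum_Pow) auto
  finally show ?thesis .
qed

text \<open>
  The substitution of \<open>\<Sum> x\<^sub>j\<close> for \<open>X\<^sub>i\<close>, the sum extending over the positions \<open>j\<close> in \<open>A\<close> at which the word
  \<open>w\<close> has the letter \<open>i\<close>.
\<close>

definition grouped_subst :: "nat list \<Rightarrow> (nat \<Rightarrow> ('a::complex_inner \<Rightarrow>\<^sub>L 'a)) \<Rightarrow> nat set \<Rightarrow> nat \<Rightarrow> ('a \<Rightarrow>\<^sub>L 'a)" where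
  "grouped_subst w x A i = (\<Sum>j | j \<in> A \<and> w ! j = i. x j)"

text \<open>
  The words in the new variables that arise when the substitution is expanded in the monomial \<open>u\<close>.
\<close>

definition index_lifts :: "nat list \<Rightarrow> nat set \<Rightarrow> nat list \<Rightarrow> nat list set" where
  "index_lifts w A u = {t. set t \<subseteq> A \<and> map ((!) w) t = u}"

lemma finite_index_lifts: "finite A \<Longrightarrow> finite (index_lifts w A u)"
  by (rule finite_subset[OF _ finite_lists_length_eq[of A "length u"]]) (auto simp: index_lifts_def)

lemma word_eval_grouped_subst:
  assumes "finite A"
  shows "word_eval (grouped_subst w x A) u = (\<Sum>t\<in>index_lifts w A u. word_eval x t)"
proof (induction u)
  case Nil
  have "index_lifts w A [] = {[]}" by (auto simp: index_lifts_def)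
  then show ?case by (simp add: word_eval_Nil)
next
  case (Cons i u)
  let ?A = "{j. j \<in> A \<and> w ! j = i}"
  have eq: "index_lifts w A (i # u) = (\<lambda>(j, t). j # t) ` (?A \<times> index_lifts w A u)"
    by (auto simp: index_lifts_def image_iff Cons_eq_map_conv)
  have "word_eval (grouped_subst w x A) (i # u) = (\<Sum>j\<in>?A. \<Sum>t\<in>index_lifts w A u. x j o\<^sub>L word_eval x t)"
    unfolding word_eval_Cons Cons grouped_subst_def compose_sum_left compose_sum_right
    by (rule sum.swap)
  also have "\<dots> = (\<Sum>(j, t)\<in>?A \<times> index_lifts w A u. word_eval x (j # t))"
    by (simp add: sum.cartesian_product word_eval_Cons)
  also have "\<dots> = (\<Sum>t\<in>index_lifts w A (i # u). word_eval x t)"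
    unfolding eq by (subst sum.reindex) (auto simp: inj_on_def intro!: sum.cong)
  finally show ?case .
qed

text \<open>
  Expanding all substitutions and exchanging the sums attaches to each word \<open>t\<close> in the new variables
  the alternating sum over the sets \<open>A\<close> that contain its letters, which leaves the words using
  all letters. These have at least the length of \<open>w\<close>, while the words that come from \<open>f\<close> are at most
  that long, so no letter is repeated.
\<close>

lemma multilin_eq_polarization:
  fixes f :: ncpoly and x :: "nat \<Rightarrow> ('a::complex_inner \<Rightarrow>\<^sub>L 'a)"
  assumes max: "\<And>u. u \<in> Poly_Mapping.keys f \<Longrightarrow> length u \<le> length w"
  defines "D \<equiv> {..<length w}"
  shows "multilin (\<lambda>t. Poly_Mapping.lookup f (map ((!) w) t)) (length w) x =
    (\<Sum>A\<in>Pow D. scaleC_op ((- 1) ^ card (D - A)) (nc_eval f (grouped_subst w x A)))"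
proof -
  let ?d = "length w" and ?f = "Poly_Mapping.lookup f" and ?K = "Poly_Mapping.keys f"
  let ?W = "\<lambda>t. scaleC_op (?f (map ((!) w) t)) (word_eval x t)"
  have fin: "finite D" by (simp add: D_def)
  have ev: "scaleC_op ((- 1) ^ card (D - A)) (nc_eval f (grouped_subst w x A)) =
      (\<Sum>u\<in>?K. \<Sum>t\<in>index_lifts w D u. scaleC_op (if set t \<subseteq> A then (- 1) ^ card (D - A) else 0) (?W t))"
    if A: "A \<in> Pow D" for A
  proof -
    have finA: "finite A" using A fin finite_subset by blast
    have "scaleC_op (?f u) (word_eval (grouped_subst w x A) u) =
        (\<Sum>t\<in>index_lifts w D u. if set t \<subseteq> A then ?W t else 0)" for u
    proof -
      have "index_lifts w A u = {t \<in> index_lifts w D u. set t \<subseteq> A}"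
        using A by (auto simp: index_lifts_def)
      then have "scaleC_op (?f u) (word_eval (grouped_subst w x A) u) =
          (\<Sum>t\<in>{t \<in> index_lifts w D u. set t \<subseteq> A}. scaleC_op (?f u) (word_eval x t))"
        by (simp add: word_eval_grouped_subst[OF finA] complex_op.scale_sum_right)
      also have "\<dots> = (\<Sum>t\<in>{t \<in> index_lifts w D u. set t \<subseteq> A}. ?W t)"
        by (rule sum.cong) (auto simp: index_lifts_def)
      finally show ?thesis
        using finite_index_lifts[OF fin] by (simp add: sum.inter_filter)
    qed
    moreover have "scaleC_op ((- 1) ^ card (D - A)) (\<Sum>t\<in>index_lifts w D u. if set t \<subseteq> A then ?W t else 0) =
        (\<Sum>t\<in>index_lifts w D u. scaleC_op (if set t \<subseteq> A then (- 1) ^ card (D - A) else 0) (?W t))" for u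
      unfolding complex_op.scale_sum_right by (rule sum.cong) auto
    ultimately show ?thesis
      by (simp only: nc_eval_def complex_op.scale_sum_right[where A = ?K])
  qed
  have "(\<Sum>A\<in>Pow D. scaleC_op ((- 1) ^ card (D - A)) (nc_eval f (grouped_subst w x A))) =
      (\<Sum>A\<in>Pow D. \<Sum>u\<in>?K. \<Sum>t\<in>index_lifts w D u.
        scaleC_op (if set t \<subseteq> A then (- 1) ^ card (D - A) else 0) (?W t))"
    by (rule sum.cong) (simp_all add: ev)
  also have "\<dots> = (\<Sum>u\<in>?K. \<Sum>t\<in>index_lifts w D u. \<Sum>A\<in>Pow D.
      scaleC_op (if set t \<subseteq> A then (- 1) ^ card (D - A) else 0) (?W t))"
    by (subst sum.swap) (intro sum.cong refl sum.swap)
  also have "\<dots> = (\<Sum>u\<in>?K. \<Sum>t\<in>index_lifts w D u. if set t = D then ?W t else 0)"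
  proof (intro sum.cong refl)
    fix u t assume "t \<in> index_lifts w D u"
    then have "set t \<subseteq> D" by (simp add: index_lifts_def)
    then show "(\<Sum>A\<in>Pow D. scaleC_op (if set t \<subseteq> A then (- 1) ^ card (D - A) else 0) (?W t)) =
        (if set t = D then ?W t else 0)"
      unfolding complex_op.scale_sum_left[symmetric] alternating_sum_supersets[OF fin \<open>set t \<subseteq> D\<close>]
      by simp
  qed
  also have "\<dots> = (\<Sum>u\<in>?K. \<Sum>t | t \<in> perm_words ?d \<and> map ((!) w) t = u. ?W t)"
  proof (rule sum.cong[OF refl])
    fix u assume u: "u \<in> ?K"
    have "{t \<in> index_lifts w D u. set t = D} = {t. t \<in> perm_words ?d \<and> map ((!) w) t = u}"
    proof -
      have "distinct t" if "set t = D" "map ((!) w) t = u" for t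
      proof (rule card_distinct)
        have "length t \<le> ?d" using max[OF u] that(2) by auto
        moreover have "card (set t) = ?d" using that(1) by (simp add: D_def)
        ultimately show "card (set t) = length t"
          using card_length[of t] by simp
      qed
      then show ?thesis
        by (auto simp: index_lifts_def perm_words_def D_def)
    qed
    then show "(\<Sum>t\<in>index_lifts w D u. if set t = D then ?W t else 0) =
        (\<Sum>t | t \<in> perm_words ?d \<and> map ((!) w) t = u. ?W t)"
      using finite_index_lifts[OF fin] by (simp flip: sum.inter_filter)
  qed
  also have "\<dots> = (\<Sum>u\<in>?K. \<Sum>t | t \<in> {t \<in> perm_words ?d. map ((!) w) t \<in> ?K} \<and> map ((!) w) t = u. ?W t)"
    by (intro sum.cong) auto
  also have "\<dots> = (\<Sum>t\<in>{t \<in> perm_words ?d. map ((!) w) t \<in> ?K}. ?W t)"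
    by (rule sum.group) (use finite_perm_words in \<open>auto\<close>)
  also have "\<dots> = (\<Sum>t\<in>perm_words ?d. ?W t)"
    using finite_perm_words by (intro sum.mono_neutral_left) (auto simp: in_keys_iff)
  finally show ?thesis
    by (simp add: multilin_def)
qed

lemma multilin_mem_span_values:
  fixes f :: ncpoly
  assumes J: "complex_op.subspace J" and x: "\<And>j. x j \<in> J"
    and max: "\<And>u. u \<in> Poly_Mapping.keys f \<Longrightarrow> length u \<le> length w"
  shows "multilin (\<lambda>t. Poly_Mapping.lookup f (map ((!) w) t)) (length w) x
    \<in> complex_op.span (nc_values f J)"
proof -
  have "grouped_subst w x A i \<in> J" for A i
    unfolding grouped_subst_def using x by (intro complex_op.subspace_sum[OF J])
  then have "nc_eval f (grouped_subst w x A) \<in> complex_op.span (nc_values f J)" for A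
    unfolding nc_values_def by (intro complex_op.span_base) blast
  note mem = this
  show ?thesis
    by (subst multilin_eq_polarization[OF max], assumption)
      (intro complex_op.span_sum complex_op.span_scale mem)
qed

section \<open>Lie ideals\<close>

text \<open>
  Let \<open>N\<close> consist of the operators whose commutators with all bounded operators lie in \<open>L\<close>. It
  contains \<open>L\<close>, and it is closed under products by the identity \<open>[t u, y] = [t, u y] + [u, y t]\<close>. From
  \<open>[x, y] r = [x, y r] - y [x, r]\<close> it follows that \<open>[x, y] r\<close> is in \<open>N\<close>, and a left factor \<open>s\<close> is moved to
  the right at the expense of a commutator of an element of \<open>N\<close>, which lies in \<open>L\<close>.
\<close>

lemma herstein:
  assumes L: "complex_op.subspace L" "L \<subseteq> bounded_ops"
    and lie: "\<And>l y. l \<in> L \<Longrightarrow> y \<in> bounded_ops \<Longrightarrow> op_comm l y \<in> L"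
    and xy: "x \<in> L" "y \<in> L" and rs: "r \<in> bounded_ops" "s \<in> bounded_ops" and z: "z \<in> bounded_ops"
  shows "op_comm (s o\<^sub>L op_comm x y o\<^sub>L r) z \<in> L"
proof -
  define N where "N = {t \<in> bounded_ops. \<forall>y\<in>bounded_ops. op_comm t y \<in> L}"
  have LN: "l \<in> N" if "l \<in> L" for l
    using that L(2) lie by (auto simp: N_def)
  have add: "t + u \<in> N" if "t \<in> N" "u \<in> N" for t u
    using that complex_op.subspace_add[OF L(1)] complex_op.subspace_add[OF bounded_ops_subspace]
    by (auto simp: N_def op_comm_add)
  have neg: "- t \<in> N" if "t \<in> N" for t
  proof -
    have "op_comm (- t) y = - op_comm t y" for y
      by (rule blinfun_eqI) (simp add: op_comm_apply blinfun.bilinear_simps)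
    then show ?thesis
      using that complex_op.subspace_neg[OF L(1)] complex_op.subspace_neg[OF bounded_ops_subspace]
      by (auto simp: N_def)
  qed
  have mult: "t o\<^sub>L u \<in> N" if t: "t \<in> N" and u: "u \<in> N" for t u
  proof -
    have "op_comm (t o\<^sub>L u) y = op_comm t (u o\<^sub>L y) + op_comm u (y o\<^sub>L t)" for y
      by (rule blinfun_eqI) (simp add: op_comm_apply blinfun.bilinear_simps)
    moreover have "op_comm t (u o\<^sub>L y) \<in> L" "op_comm u (y o\<^sub>L t) \<in> L" if "y \<in> bounded_ops" for y
      using t u that by (auto simp: N_def bounded_ops_compose)
    ultimately show ?thesis
      using t u complex_op.subspace_add[OF L(1)] by (auto simp: N_def bounded_ops_compose)
  qed
  have right: "op_comm x y o\<^sub>L q \<in> N" if q: "q \<in> bounded_ops" for q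
  proof -
    have eq: "op_comm x y o\<^sub>L q = op_comm x (y o\<^sub>L q) + - (y o\<^sub>L op_comm x q)"
      by (rule blinfun_eqI) (simp add: op_comm_apply blinfun.bilinear_simps)
    have "y o\<^sub>L q \<in> bounded_ops"
      using xy(2) L(2) q bounded_ops_compose by blast
    then show ?thesis
      unfolding eq by (intro add neg mult LN lie xy q)
  qed
  have eq: "s o\<^sub>L op_comm x y o\<^sub>L r = - op_comm (op_comm x y o\<^sub>L r) s + (op_comm x y o\<^sub>L (r o\<^sub>L s))"
    by (rule blinfun_eqI) (simp add: op_comm_apply blinfun.bilinear_simps)
  have "op_comm (op_comm x y o\<^sub>L r) s \<in> N"
    using right[OF rs(1)] rs(2) LN by (auto simp: N_def)
  then have "s o\<^sub>L op_comm x y o\<^sub>L r \<in> N"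
    unfolding eq by (intro add neg right bounded_ops_compose rs)
  then show ?thesis
    using z by (simp add: N_def)
qed

section \<open>Ideals are spanned by the values of a polynomial\<close>

context approx_unital_ideal
begin

text \<open>
  The span of the values is a Lie ideal \<open>L\<close> containing the off-diagonal corners \<open>S\<^sub>0 a T\<^sub>d\<close> and \<open>S\<^sub>d b T\<^sub>0\<close>.
  The commutator of two of these is diagonal, and its corner \<open>a b\<close> is an arbitrary element of \<open>J\<close>, to
  which Herstein's lemma applies.
\<close>

lemma ideal_subset_multilin_span:
  fixes S T S' T' :: "'a \<Rightarrow>\<^sub>L 'a"
  assumes c: "cuntz_pair S T S' T'" and d: "d > 0" and c0: "c [0..<d] \<noteq> 0"
  shows "J \<subseteq> complex_op.span {multilin c d x |x. \<forall>j. x j \<in> J}"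
proof
  let ?G = "{multilin c d x |x. \<forall>j. x j \<in> J}"
  let ?S = "branch S S'" and ?T = "cobranch T T'"
  define L where "L = complex_op.span ?G"
  have L: "complex_op.subspace L"
    by (simp add: L_def)
  have comm_J: "op_comm l y \<in> J" if "l \<in> J" "y \<in> bounded_ops" for l y
    unfolding op_comm_def using that by (intro complex_op.subspace_diff[OF subspace] left right)
  have "?G \<subseteq> bounded_ops"
    using bounded
    by (auto simp: multilin_def intro!: complex_op.subspace_sum[OF bounded_ops_subspace]
        complex_op.subspace_scale[OF bounded_ops_subspace] word_eval_bounded_ops)
  then have Lb: "L \<subseteq> bounded_ops"
    unfolding L_def by (rule complex_op.span_minimal[OF _ bounded_ops_subspace])
  have lie: "op_comm l y \<in> L" if l: "l \<in> L" and y: "y \<in> bounded_ops" for l y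
    using l unfolding L_def
  proof (induction rule: complex_op.span_induct_alt)
    case base
    show ?case by (simp add: complex_op.span_zero)
  next
    case (step q l l')
    then obtain x where x: "l = multilin c d x" "\<forall>j. x j \<in> J" by blast
    have "op_comm l y \<in> complex_op.span ?G"
      unfolding x(1) op_comm_multilin[OF y]
    proof (intro complex_op.span_sum complex_op.span_base)
      fix k
      show "multilin c d (x(k := op_comm (x k) y)) \<in> ?G"
        using x(2) y by (auto intro!: exI[of _ "x(k := op_comm (x k) y)"] comm_J)
    qed
    with step show ?case
      by (simp add: op_comm_add op_comm_scaleC[OF y] complex_op.span_add complex_op.span_scale)
  qed
  have corner: "?S (p 0) o\<^sub>L a o\<^sub>L ?T (p d) \<in> L" if p: "inj p" and a: "a \<in> J" for p :: "nat \<Rightarrow> nat" and a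
  proof -
    obtain b where b: "\<forall>j. b j \<in> J" "word_eval b [0..<d] = a"
      using multiple_factorization[OF c a d] by blast
    have mem: "?S (p j) o\<^sub>L b j o\<^sub>L ?T (p (Suc j)) \<in> J" for j
      using b(1) branch_bounded_ops[OF c] by (blast intro: right left)
    have "scaleC_op (c [0..<d]) (?S (p 0) o\<^sub>L a o\<^sub>L ?T (p d)) =
        multilin c d (\<lambda>j. ?S (p j) o\<^sub>L b j o\<^sub>L ?T (p (Suc j)))"
      unfolding multilin_chain[OF c p d] b(2) ..
    also have "\<dots> \<in> L"
      using mem unfolding L_def by (intro complex_op.span_base) blast
    finally have "scaleC_op (inverse (c [0..<d])) (scaleC_op (c [0..<d])
        (?S (p 0) o\<^sub>L a o\<^sub>L ?T (p d))) \<in> L"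
      by (rule complex_op.subspace_scale[OF L])
    then show ?thesis
      using c0 by (simp add: complex_op.scale_scale)
  qed
  have comm_L: "op_comm y z \<in> L" if y: "y \<in> J" and z: "z \<in> bounded_ops" for y z
  proof -
    obtain a b where ab: "a \<in> J" "b \<in> J" "y = a o\<^sub>L b"
      using factorization[OF c y] by blast
    \<comment> \<open>a relabelling that reverses the ends of the chain\<close>
    let ?p = "Transposition.transpose 0 d"
    have 1: "?S 0 o\<^sub>L a o\<^sub>L ?T d \<in> L"
      using corner[of "\<lambda>j. j" a] ab by simp
    have 2: "?S d o\<^sub>L b o\<^sub>L ?T 0 \<in> L"
      using corner[of ?p b] ab by simp
    have "?T 0 o\<^sub>L op_comm (?S 0 o\<^sub>L a o\<^sub>L ?T d) (?S d o\<^sub>L b o\<^sub>L ?T 0) o\<^sub>L ?S 0 = y"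
      using d by (intro blinfun_eqI)
        (simp add: op_comm_apply ab(3) cobranch_branch[OF c] blinfun.bilinear_simps)
    then show ?thesis
      using herstein[OF L Lb lie 1 2 _ _ z] branch_bounded_ops[OF c] by metis
  qed
  fix a assume "a \<in> J"
  then obtain y z where "y \<in> J" "z \<in> J" "a = op_comm y S + op_comm z S'"
    using sum_of_commutators[OF c] by blast
  then show "a \<in> complex_op.span ?G"
    using comm_L cuntz_pairD(1,3)[OF c] complex_op.subspace_add[OF L] unfolding L_def by blast
qed

lemma ideal_subset_span_values:
  fixes S T S' T' :: "'a \<Rightarrow>\<^sub>L 'a" and f :: ncpoly
  assumes c: "cuntz_pair S T S' T'" and f: "f \<notin> range (Poly_Mapping.single [])"
  shows "J \<subseteq> complex_op.span (nc_values f J)"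
proof -
  let ?K = "Poly_Mapping.keys f"
  have "\<exists>u\<in>?K. u \<noteq> []"
  proof (rule ccontr)
    assume "\<not> ?thesis"
    then have "Poly_Mapping.lookup f k = 0" if "k \<noteq> []" for k
      using that in_keys_iff[of k f] by blast
    then have "f = Poly_Mapping.single [] (Poly_Mapping.lookup f [])"
      by (intro poly_mapping_eqI) (simp add: lookup_single when_def)
    with f show False by blast
  qed
  then obtain u where u: "u \<in> ?K" "u \<noteq> []" by blast
  have "Max (length ` ?K) \<in> length ` ?K"
    using u(1) by (intro Max_in) auto
  then obtain w where w: "w \<in> ?K" and len: "length w = Max (length ` ?K)"
    by (metis imageE)
  have max: "length v \<le> length w" if "v \<in> ?K" for v
    unfolding len using that by (intro Max_ge) auto
  have pos: "length w > 0"
    using max[OF u(1)] u(2) by (cases w) auto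
  let ?c = "\<lambda>t. Poly_Mapping.lookup f (map ((!) w) t)"
  have "?c [0..<length w] \<noteq> 0"
    using w by (simp add: map_nth in_keys_iff)
  then have "J \<subseteq> complex_op.span {multilin ?c (length w) x |x. \<forall>j. x j \<in> J}"
    by (rule ideal_subset_multilin_span[OF c pos])
  also have "\<dots> \<subseteq> complex_op.span (nc_values f J)"
    using multilin_mem_span_values[OF subspace _ max]
    by (intro complex_op.span_minimal complex_op.subspace_span) auto
  finally show ?thesis .
qed

end

lemma approx_unital_ideal_bounded_ops:
  "approx_unital_ideal (bounded_ops :: ('a::chilbert_space \<Rightarrow>\<^sub>L 'a) set)"
proof
  fix a :: "'a \<Rightarrow>\<^sub>L 'a" and e :: real assume "e > 0"
  have "a - (id_blinfun o\<^sub>L a) = 0" by (rule blinfun_eqI) (simp add: blinfun.diff_left)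
  with \<open>e > 0\<close> show "\<exists>p\<in>bounded_ops. norm p \<le> 1 \<and> norm (a - (p o\<^sub>L a)) \<le> e"
    using norm_blinfun_id_le by (intro bexI[of _ id_blinfun]) (auto simp: id_bounded_ops)
qed (simp_all add: bounded_ops_subspace closed_bounded_ops bounded_ops_compose)

lemma approx_unital_ideal_compact_ops:
  "approx_unital_ideal (compact_ops :: ('a::chilbert_space \<Rightarrow>\<^sub>L 'a) set)"
  by standard
    (simp_all add: compact_ops_subspace closed_compact_ops compact_ops_compose_left
      compact_ops_compose_right compact_ops_bounded_ops compact_ops_approx_unit)

lemma nc_values_bounded_ops: "nc_values f bounded_ops \<subseteq> bounded_ops"
  by (auto simp: nc_values_def nc_eval_def intro!: word_eval_bounded_ops
      complex_op.subspace_sum[OF bounded_ops_subspace]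
      complex_op.subspace_scale[OF bounded_ops_subspace])

lemma nc_values_compact_ops:
  assumes "Poly_Mapping.lookup f [] = 0"
  shows "nc_values f compact_ops \<subseteq> compact_ops"
proof -
  have "word_eval a u \<in> compact_ops" if a: "\<forall>i. a i \<in> compact_ops" and "u \<noteq> []"
    for u and a :: "nat \<Rightarrow> ('a \<Rightarrow>\<^sub>L 'a)"
  proof -
    obtain i v where "u = i # v" using \<open>u \<noteq> []\<close> by (cases u) auto
    moreover have "word_eval a v \<in> bounded_ops"
      using a compact_ops_bounded_ops by (intro word_eval_bounded_ops) blast
    ultimately show ?thesis
      using a by (simp add: word_eval_Cons compact_ops_compose_right)
  qed
  moreover have "u \<noteq> []" if "u \<in> Poly_Mapping.keys f" for u
    using that assms by (auto simp: in_keys_iff)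
  ultimately show ?thesis
    unfolding nc_values_def nc_eval_def
    by (auto intro!: complex_op.subspace_sum[OF compact_ops_subspace]
        complex_op.subspace_scale[OF compact_ops_subspace])
qed

theorem corollary2p5:
  fixes f :: ncpoly
  assumes infinite_dim: "\<nexists>B :: 'a::chilbert_space set. finite B \<and> complex_vector.span B = UNIV"
    and nonconstant: "f \<notin> range (Poly_Mapping.single [])"
  shows "complex_op.span (nc_values f bounded_ops) = (bounded_ops :: ('a \<Rightarrow>\<^sub>L 'a) set) \<and>
    (Poly_Mapping.lookup f [] = 0 \<longrightarrow>
      complex_op.span (nc_values f compact_ops) = (compact_ops :: ('a \<Rightarrow>\<^sub>L 'a) set))"
proof -
  obtain S T S' T' :: "'a \<Rightarrow>\<^sub>L 'a" where c: "cuntz_pair S T S' T'"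
    using ex_cuntz_pair[OF infinite_dim] by blast
  note sub = approx_unital_ideal.ideal_subset_span_values[OF _ c nonconstant]
  show ?thesis
    using sub[OF approx_unital_ideal_bounded_ops] sub[OF approx_unital_ideal_compact_ops]
      complex_op.span_minimal[OF nc_values_bounded_ops bounded_ops_subspace]
      complex_op.span_minimal[OF nc_values_compact_ops compact_ops_subspace]
    by blast
qed

end
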